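(* Let $T>0$ and let $\gamma(t)$, $0\le t\le T$, be a simple continuous curve in $\mathbb H\cup\{0\}$ with $\gamma(t)\in C^1$, meaning that the tangent vector $\gamma'(t)$ exists and varies continuously on $[0,T]$. Suppose that $\gamma(0)=0$, that $\operatorname{Im}\gamma(t)>0$ for $t>0$, and that $\gamma$ is perpendicular to the real axis $\mathbb R$ (at the origin). Let $f(z,t)$ map $\mathbb H\setminus\gamma[0,t]$ onto $\mathbb H$, with the normalization $f(z,t)=z+\frac{2t}{z}+O\left(\frac1{z^2}\right)$ near infinity, and solve the chordal Löwner differential equation $$\frac{df(z,t)}{dt}=\frac{2}{f(z,t)-\lambda(t)},\qquad f(z,0)\equiv z,$$ with the real-valued continuous driving function $\lambda(t)$. Let $\gamma_1(t)$ and $\gamma_2(t)$ be the two sides of the slit $\gamma[0,t]$, and let $$m_k(t):=\omega\bigl(f^{-1}(i,t);\gamma_k(t),\mathbb H\setminus\gamma[0,t]\bigr),\qquad k=1,2,$$ be the harmonic measure of $\gamma_k(t)$ at the point $f^{-1}(i,t)$ with respect to $\mathbb H\setminus\gamma[0,t]$. Then $$\lim_{t\to+0}\frac{m_1(t)}{m_2(t)}=1.$$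
   Context: $\mathbb H=\{z\in\mathbb C:\operatorname{Im}z>0\}$ and $\mathbb R=\partial\mathbb H$. Here $f^{-1}(\cdot,t)$ denotes the inverse of the conformal map $f(\cdot,t)$. The function $f(\cdot,t)$ extends continuously to $\mathbb R$ and to the slit (each side of the slit being treated separately), with $f(\gamma(t),t)=\lambda(t)$. The extended function maps $\gamma[0,t]$ onto a segment $I=[f_2(0,t),f_1(0,t)]\subset\mathbb R$, and $\mathbb R$ onto $\mathbb R\setminus I$. The two sides $\gamma_1(t),\gamma_2(t)$ of the slit consist of the same points but define different prime ends of $\mathbb H\setminus\gamma[0,t]$, except for the tip. The two parts $[\lambda(t),f_1(0,t)]$ and $[f_2(0,t),\lambda(t)]$ of $I$ are the images of the two sides under $f(\cdot,t)$. The harmonic measure $\omega(z;\gamma_k(t),\mathbb H\setminus\gamma[0,t])$ is the value at $z$ of the function $\omega_k$ which is harmonic on $\mathbb H\setminus\gamma[0,t]$, extends continuously to the closure (with the two sides of the slit distinguished) except for the endpoints of the slit, and has boundary values $1$ on $\gamma_k(t)$ and $0$ on $\mathbb R$ and on the other side of the slit.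
   Formalization: The condition that γ'(t) exists and is continuous on [0,T] cannot hold at t=0 in this parametrization (e.g. γ(t)=2i√t); it is read as: some increasing reparametrization of γ is C^1 up to the origin with nonvanishing tangent. Harmonic measure is taken to be bounded. *)

theory Defs
  imports "HOL-Complex_Analysis.Complex_Analysis" "HOL-Library.Landau_Symbols"
begin

definition upper_half_plane :: "complex set" where
  "upper_half_plane = {z. 0 < Im z}"

definition slit_domain :: "(real \<Rightarrow> complex) \<Rightarrow> real \<Rightarrow> complex set" where
  "slit_domain \<gamma> t = upper_half_plane - \<gamma> ` {0..t}"

(* C^1 is a property of the geometric curve: some increasing change of parameter makes it
   continuously differentiable with nonvanishing derivative; \<tau> t is the tangent vector at \<gamma> t.
   It cannot be asked of the parameter t itself, because t is also half the half-plane capacity of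
   \<gamma>[0,t]: then sup |\<gamma>| over [0,t] is of order at least sqrt t (\<gamma> t = 2 i sqrt t for the vertical
   slit), so that \<gamma> is never differentiable at t = 0. *)
definition C1_curve_with_tangent ::
    "(real \<Rightarrow> complex) \<Rightarrow> real \<Rightarrow> (real \<Rightarrow> complex) \<Rightarrow> bool" where
  "C1_curve_with_tangent \<gamma> T \<tau> \<longleftrightarrow>
     continuous_on {0..T} \<tau> \<and> (\<forall>t\<in>{0..T}. \<tau> t \<noteq> 0) \<and>
     (\<exists>L \<phi>. 0 < L \<and> strict_mono_on {0..L} \<phi> \<and> \<phi> ` {0..L} = {0..T} \<and>
        (\<forall>s\<in>{0..L}. ((\<gamma> \<circ> \<phi>) has_vector_derivative \<tau> (\<phi> s)) (at s within {0..L})))"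

(* u is C^2 with zero Laplacian: p, q are the first derivatives u_x, u_y and
   a, b, c the second derivatives u_xx, u_xy = u_yx, u_yy. *)
definition harmonic_on :: "(complex \<Rightarrow> real) \<Rightarrow> complex set \<Rightarrow> bool" where
  "harmonic_on u S \<longleftrightarrow>
     (\<exists>p q a b c.
        continuous_on S a \<and> continuous_on S b \<and> continuous_on S c \<and>
        (\<forall>z\<in>S. (u has_derivative (\<lambda>h. p z * Re h + q z * Im h)) (at z) \<and>
               (p has_derivative (\<lambda>h. a z * Re h + b z * Im h)) (at z) \<and>
               (q has_derivative (\<lambda>h. b z * Re h + c z * Im h)) (at z) \<and>
               a z + c z = 0))"

(* Approach to the prime end of \<Omega> at the boundary point p that lies on the side of p to which
   the vector n points: for every r > 0, z is eventually in the component of \<Omega> \<inter> ball p r that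
   contains the points p + \<epsilon> n for all small \<epsilon> > 0. *)
definition at_side :: "complex set \<Rightarrow> complex \<Rightarrow> complex \<Rightarrow> complex filter" where
  "at_side \<Omega> p n =
     (INF r\<in>{0<..}. principal
        {z. \<forall>\<^sub>F \<epsilon> in at_right 0.
              connected_component (\<Omega> \<inter> ball p r) (p + of_real \<epsilon> * n) z})"

(* \<omega> z is the harmonic measure at z, with respect to slit_domain \<gamma> t, of the side of the slit to
   which the normal vectors \<nu> s at \<gamma> s point. No boundary condition is imposed at the end points
   \<gamma> 0 = 0 and \<gamma> t of the slit, nor at infinity; boundedness is what makes \<omega> unique
   (otherwise, e.g., the imaginary part of a conformal map onto the half-plane could be added). *)
definition harmonic_measure_of_side ::
    "(real \<Rightarrow> complex) \<Rightarrow> (real \<Rightarrow> complex) \<Rightarrow> real \<Rightarrow> (complex \<Rightarrow> real) \<Rightarrow> bool" where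
  "harmonic_measure_of_side \<gamma> \<nu> t \<omega> \<longleftrightarrow>
     harmonic_on \<omega> (slit_domain \<gamma> t) \<and>
     bounded (\<omega> ` slit_domain \<gamma> t) \<and>
     (\<forall>s\<in>{0<..<t}. (\<omega> \<longlongrightarrow> 1) (at_side (slit_domain \<gamma> t) (\<gamma> s) (\<nu> s))) \<and>
     (\<forall>s\<in>{0<..<t}. (\<omega> \<longlongrightarrow> 0) (at_side (slit_domain \<gamma> t) (\<gamma> s) (- \<nu> s))) \<and>
     (\<forall>x. x \<noteq> 0 \<longrightarrow> (\<omega> \<longlongrightarrow> 0) (at (complex_of_real x) within slit_domain \<gamma> t))"

end

theory Submission
  imports Defs
begin

text \<open>
  Only the part of the curve close to the origin matters, and there the \<open>C\<^sup>1\<close> condition makes the slit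
  a graph \<open>x = g y\<close>, \<open>0 \<le> y \<le> h\<close>, with a Lipschitz constant \<open>\<epsilon>\<close> that tends to \<open>0\<close> with \<open>t\<close>. Let \<open>b\<close> be its
  tip. With the branch of the logarithm cut along the slit, the bounded harmonic function
  \<open>- Im (log ((z - b) (z - cnj b) / z\<^sup>2)) / \<pi>\<close> vanishes on the real axis, and on the two sides of
  the slit it differs from \<open>1\<close> and \<open>-1\<close> by \<open>O(\<epsilon>)\<close>, since it is a combination of
  angles between chords of the slit. By the maximum principle it differs from \<open>\<omega>1 - \<omega>2\<close> by at most
  \<open>O(\<epsilon>) (\<omega>1 + \<omega>2)\<close>, and near \<open>\<i>\<close> it is \<open>O(\<epsilon> h + h\<^sup>2)\<close>. Comparing with the imaginary part of
  \<open>z - sqrt ((z - b) (z - cnj b))\<close>, which is at most \<open>2 h\<close> and near \<open>\<i>\<close> at least \<open>h\<^sup>2 / 36\<close>,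
  shows that \<open>\<omega>1 + \<omega>2\<close> is at least \<open>h / 72\<close> there. Hence \<open>\<omega>1 - \<omega>2 = o(\<omega>1 + \<omega>2)\<close>
  near \<open>\<i>\<close>. Finally, the Loewner equation moves the point
  with image \<open>\<i>\<close> by at most \<open>2 t\<close>, because its imaginary part stays at least \<open>1\<close>.
\<close>

section \<open>The maximum principle for harmonic functions\<close>

lemma harmonic_on_by_derivatives:
  assumes "continuous_on S a" "continuous_on S b" "continuous_on S c"
    and "\<And>z. z \<in> S \<Longrightarrow> (u has_derivative (\<lambda>h. p z * Re h + q z * Im h)) (at z)"
    and "\<And>z. z \<in> S \<Longrightarrow> (p has_derivative (\<lambda>h. a z * Re h + b z * Im h)) (at z)"
    and "\<And>z. z \<in> S \<Longrightarrow> (q has_derivative (\<lambda>h. b z * Re h + c z * Im h)) (at z)"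
    and "\<And>z. z \<in> S \<Longrightarrow> a z + c z = 0"
  shows "harmonic_on u S"
  unfolding harmonic_on_def
  by (rule exI[of _ p], rule exI[of _ q], rule exI[of _ a], rule exI[of _ b], rule exI[of _ c])
    (intro conjI ballI assms)

text \<open>Locally \<open>u\<close> is the real part of a primitive of \<open>G\<close>, so its
  gradient is (Re G, - Im G), and the Cauchy-Riemann equations for \<open>G\<close> make the matrix
  of second derivatives symmetric with trace zero. Only the gradient has to be single-valued, so
  multivalued primitives such as log (z - c) are covered.\<close>

lemma harmonic_onI:
  assumes "open S" and "G holomorphic_on S"
    and der: "\<And>z. z \<in> S \<Longrightarrow> (u has_derivative (\<lambda>h. Re (G z * h))) (at z)"
  shows "harmonic_on u S"
proof -
  have G': "(G has_field_derivative deriv G z) (at z)" if "z \<in> S" for z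
    using assms that holomorphic_derivI by blast
  have cont: "continuous_on S (deriv G)"
    using assms by (intro holomorphic_on_imp_continuous_on holomorphic_deriv)
  have "(u has_derivative (\<lambda>h. Re (G z) * Re h + - Im (G z) * Im h)) (at z)"
    "((\<lambda>z. Re (G z)) has_derivative (\<lambda>h. Re (deriv G z) * Re h + - Im (deriv G z) * Im h)) (at z)"
    "((\<lambda>z. - Im (G z)) has_derivative (\<lambda>h. - Im (deriv G z) * Re h + - Re (deriv G z) * Im h)) (at z)"
    if "z \<in> S" for z
  proof -
    show "(u has_derivative (\<lambda>h. Re (G z) * Re h + - Im (G z) * Im h)) (at z)"
      using der[OF that] by simp
    have *: "(G has_derivative (*) (deriv G z)) (at z)"
      using G'[OF that] by (simp add: has_field_derivative_def)
    show "((\<lambda>z. Re (G z)) has_derivative (\<lambda>h. Re (deriv G z) * Re h + - Im (deriv G z) * Im h)) (at z)"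
      using has_derivative_Re[OF *] by simp
    show "((\<lambda>z. - Im (G z)) has_derivative (\<lambda>h. - Im (deriv G z) * Re h + - Re (deriv G z) * Im h)) (at z)"
      using has_derivative_minus[OF has_derivative_Im[OF *]] by (simp add: algebra_simps)
  qed
  moreover have "continuous_on S (\<lambda>z. Re (deriv G z))" "continuous_on S (\<lambda>z. - Im (deriv G z))"
    "continuous_on S (\<lambda>z. - Re (deriv G z))"
    using cont by (auto intro!: continuous_intros)
  ultimately show ?thesis
    by (intro harmonic_on_by_derivatives[where p = "\<lambda>z. Re (G z)" and q = "\<lambda>z. - Im (G z)"
          and a = "\<lambda>z. Re (deriv G z)" and b = "\<lambda>z. - Im (deriv G z)"
          and c = "\<lambda>z. - Re (deriv G z)"]) simp_all
qed

lemma harmonic_on_Im: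
  assumes "open S" "\<And>z. z \<in> S \<Longrightarrow> (F has_field_derivative F' z) (at z)"
  shows "harmonic_on (\<lambda>z. Im (F z)) S"
proof (rule harmonic_onI[OF assms(1)])
  have hol: "F holomorphic_on S"
    using assms holomorphic_on_open by blast
  \<comment> \<open>Im F = Re (- \<i> F), so the gradient function is - \<i> F'.\<close>
  then show "(\<lambda>z. - \<i> * deriv F z) holomorphic_on S"
    using assms(1) by (intro holomorphic_intros)
  fix z assume "z \<in> S"
  then have "(F has_derivative (*) (deriv F z)) (at z)"
    using hol assms(1) holomorphic_derivI unfolding has_field_derivative_def[symmetric] by blast
  from has_derivative_Im[OF this]
  show "((\<lambda>z. Im (F z)) has_derivative (\<lambda>h. Re (- \<i> * deriv F z * h))) (at z)"
    by (simp add: algebra_simps)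
qed

lemma harmonic_on_ln_norm:
  assumes "open S" "c \<notin> S"
  shows "harmonic_on (\<lambda>z. ln (cmod (z - c))) S"
proof (rule harmonic_onI[OF assms(1)])
  show "(\<lambda>z. 1 / (z - c)) holomorphic_on S"
    using assms(2) by (intro holomorphic_intros) auto
  fix z assume "z \<in> S"
  then have nz: "z - c \<noteq> 0" using assms(2) by auto
  have "((\<lambda>z. z - c) has_derivative (\<lambda>h. h)) (at z)"
    by (rule has_derivative_eq_rhs) (auto intro!: derivative_eq_intros)
  from has_derivative_compose[OF this has_derivative_norm[OF nz]]
  have *: "((\<lambda>z. cmod (z - c)) has_derivative (\<lambda>h. h \<bullet> sgn (z - c))) (at z)" .
  have "((\<lambda>z. ln (cmod (z - c))) has_derivative (\<lambda>h. (h \<bullet> sgn (z - c)) * inverse (cmod (z - c)))) (at z)"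
    using * nz by (auto intro!: derivative_eq_intros)
  moreover have "(h \<bullet> sgn (z - c)) * inverse (cmod (z - c)) = Re (1 / (z - c) * h)" for h
  proof -
    have "h \<bullet> sgn (z - c) = h \<bullet> (z - c) / cmod (z - c)"
      unfolding sgn_div_norm by (simp add: divide_inverse mult.commute)
    moreover have "Re (1 / (z - c) * h) = (h \<bullet> (z - c)) / (cmod (z - c))\<^sup>2"
      unfolding cmod_power2 by (simp add: Re_divide inner_complex_def field_simps)
    ultimately show ?thesis by (simp add: power2_eq_square divide_inverse)
  qed
  ultimately show "((\<lambda>z. ln (cmod (z - c))) has_derivative (\<lambda>h. Re (1 / (z - c) * h))) (at z)"
    by simp
qed

lemma harmonic_on_add:
  assumes "harmonic_on u S" "harmonic_on v S"
  shows "harmonic_on (\<lambda>z. u z + v z) S"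
proof -
  obtain p q a b c where 1: "continuous_on S a" "continuous_on S b" "continuous_on S c"
    "\<And>z. z \<in> S \<Longrightarrow> (u has_derivative (\<lambda>h. p z * Re h + q z * Im h)) (at z)"
    "\<And>z. z \<in> S \<Longrightarrow> (p has_derivative (\<lambda>h. a z * Re h + b z * Im h)) (at z)"
    "\<And>z. z \<in> S \<Longrightarrow> (q has_derivative (\<lambda>h. b z * Re h + c z * Im h)) (at z)"
    "\<And>z. z \<in> S \<Longrightarrow> a z + c z = 0"
    using assms(1) unfolding harmonic_on_def by blast
  obtain p' q' a' b' c' where 2: "continuous_on S a'" "continuous_on S b'" "continuous_on S c'"
    "\<And>z. z \<in> S \<Longrightarrow> (v has_derivative (\<lambda>h. p' z * Re h + q' z * Im h)) (at z)"
    "\<And>z. z \<in> S \<Longrightarrow> (p' has_derivative (\<lambda>h. a' z * Re h + b' z * Im h)) (at z)"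
    "\<And>z. z \<in> S \<Longrightarrow> (q' has_derivative (\<lambda>h. b' z * Re h + c' z * Im h)) (at z)"
    "\<And>z. z \<in> S \<Longrightarrow> a' z + c' z = 0"
    using assms(2) unfolding harmonic_on_def by blast
  have "((\<lambda>z. u z + v z) has_derivative (\<lambda>h. (p z + p' z) * Re h + (q z + q' z) * Im h)) (at z)"
    "((\<lambda>z. p z + p' z) has_derivative (\<lambda>h. (a z + a' z) * Re h + (b z + b' z) * Im h)) (at z)"
    "((\<lambda>z. q z + q' z) has_derivative (\<lambda>h. (b z + b' z) * Re h + (c z + c' z) * Im h)) (at z)"
    "(a z + a' z) + (c z + c' z) = 0" if "z \<in> S" for z
    using has_derivative_add[OF 1(4) 2(4)] has_derivative_add[OF 1(5) 2(5)]
      has_derivative_add[OF 1(6) 2(6)] 1(7) 2(7) that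
    by (simp_all add: algebra_simps)
  moreover have "continuous_on S (\<lambda>z. a z + a' z)" "continuous_on S (\<lambda>z. b z + b' z)"
    "continuous_on S (\<lambda>z. c z + c' z)"
    using 1(1-3) 2(1-3) by (auto intro!: continuous_intros)
  ultimately show ?thesis
    by (intro harmonic_on_by_derivatives[where p = "\<lambda>z. p z + p' z" and q = "\<lambda>z. q z + q' z"
          and a = "\<lambda>z. a z + a' z" and b = "\<lambda>z. b z + b' z" and c = "\<lambda>z. c z + c' z"])
qed

lemma harmonic_on_cmult:
  assumes "harmonic_on u S"
  shows "harmonic_on (\<lambda>z. k * u z) S"
proof -
  obtain p q a b c where 1: "continuous_on S a" "continuous_on S b" "continuous_on S c"
    "\<And>z. z \<in> S \<Longrightarrow> (u has_derivative (\<lambda>h. p z * Re h + q z * Im h)) (at z)"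
    "\<And>z. z \<in> S \<Longrightarrow> (p has_derivative (\<lambda>h. a z * Re h + b z * Im h)) (at z)"
    "\<And>z. z \<in> S \<Longrightarrow> (q has_derivative (\<lambda>h. b z * Re h + c z * Im h)) (at z)"
    "\<And>z. z \<in> S \<Longrightarrow> a z + c z = 0"
    using assms unfolding harmonic_on_def by blast
  have "((\<lambda>z. k * u z) has_derivative (\<lambda>h. k * p z * Re h + k * q z * Im h)) (at z)"
    "((\<lambda>z. k * p z) has_derivative (\<lambda>h. k * a z * Re h + k * b z * Im h)) (at z)"
    "((\<lambda>z. k * q z) has_derivative (\<lambda>h. k * b z * Re h + k * c z * Im h)) (at z)"
    "k * a z + k * c z = 0" if "z \<in> S" for z
  proof -
    show "k * a z + k * c z = 0"
      using 1(7)[OF that] by (metis distrib_left mult_zero_right)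
  qed (use has_derivative_mult_right[OF 1(4)[OF that], of k] has_derivative_mult_right[OF 1(5)[OF that], of k]
      has_derivative_mult_right[OF 1(6)[OF that], of k] in \<open>simp_all add: algebra_simps\<close>)
  moreover have "continuous_on S (\<lambda>z. k * a z)" "continuous_on S (\<lambda>z. k * b z)"
    "continuous_on S (\<lambda>z. k * c z)"
    using 1(1-3) by (auto intro!: continuous_intros)
  ultimately show ?thesis
    by (intro harmonic_on_by_derivatives[where p = "\<lambda>z. k * p z" and q = "\<lambda>z. k * q z"
          and a = "\<lambda>z. k * a z" and b = "\<lambda>z. k * b z" and c = "\<lambda>z. k * c z"])
qed

lemma harmonic_on_diff:
  assumes "harmonic_on u S" "harmonic_on v S"
  shows "harmonic_on (\<lambda>z. u z - v z) S"
  using harmonic_on_add[OF assms(1) harmonic_on_cmult[OF assms(2), of "-1"]] by simp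

lemma harmonic_on_const: "open S \<Longrightarrow> harmonic_on (\<lambda>z. k) S"
  by (rule harmonic_onI[of _ "\<lambda>_. 0"]) auto

section \<open>The maximum principle by a strictly subharmonic perturbation\<close>

lemma harmonic_on_imp_continuous_at:
  assumes "harmonic_on u S" "z \<in> S"
  shows "isCont u z"
proof -
  obtain p q where "\<And>z. z \<in> S \<Longrightarrow> (u has_derivative (\<lambda>h. p z * Re h + q z * Im h)) (at z)"
    using assms(1) unfolding harmonic_on_def by blast
  then show ?thesis using assms(2) has_derivative_continuous by blast
qed

text \<open>If \<open>d\<close> were positive, \<open>k'\<close> would vanish at 0 and be positive
  just to the right of it, and the mean value theorem would make \<open>k\<close> exceed
  \<open>k 0\<close> there.\<close>

lemma second_derivative_nonpos_at_max:
  fixes k :: "real \<Rightarrow> real"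
  assumes k: "\<forall>\<^sub>F x in nhds 0. (k has_real_derivative k' x) (at x)"
    and k': "(k' has_real_derivative d) (at 0)"
    and max: "\<forall>\<^sub>F x in nhds 0. k x \<le> k 0"
  shows "d \<le> 0"
proof (rule ccontr)
  assume "\<not> d \<le> 0"
  then have "d > 0" by simp
  obtain e1 where e1: "e1 > 0" "\<And>x. \<bar>x\<bar> < e1 \<Longrightarrow> (k has_real_derivative k' x) (at x)"
    using k unfolding eventually_nhds_metric by (auto simp: dist_real_def)
  obtain e2 where e2: "e2 > 0" "\<And>x. \<bar>x\<bar> < e2 \<Longrightarrow> k x \<le> k 0"
    using max unfolding eventually_nhds_metric by (auto simp: dist_real_def)
  have "k' 0 = 0"
    using DERIV_local_max[OF e1(2)[of 0] e2(1)] e1(1) e2(2) by auto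
  obtain e3 where e3: "e3 > 0" "\<And>x. 0 < x \<Longrightarrow> x < e3 \<Longrightarrow> k' 0 < k' (0 + x)"
    using DERIV_pos_inc_right[OF k' \<open>d > 0\<close>] by blast
  define x where "x = min e1 (min e2 e3) / 2"
  have x: "0 < x" "x < e1" "x < e2" "x < e3"
    using e1(1) e2(1) e3(1) by (auto simp: x_def)
  obtain y where "0 < y" "y < x" "k x - k 0 = (x - 0) * k' y"
    using MVT2[of 0 x k k'] x e1(2) by auto
  moreover have "k' y > 0" using e3(2)[of y] \<open>k' 0 = 0\<close> x calculation by auto
  ultimately have "k x > k 0" using x by (metis diff_gt_0_iff_gt diff_zero mult_pos_pos)
  then show False using e2(2)[of x] x by auto
qed

text \<open>The Laplacian of the sum is 4 \<kappa> > 0, whereas at a local maximum the second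
  derivatives along the horizontal and the vertical line are both nonpositive.\<close>

lemma no_local_max_harmonic_plus_square:
  assumes "open S" "harmonic_on v S" "z0 \<in> S" "\<kappa> > 0"
    and max: "\<forall>\<^sub>F z in nhds z0. v z + \<kappa> * (cmod z)\<^sup>2 \<le> v z0 + \<kappa> * (cmod z0)\<^sup>2"
  shows False
proof -
  obtain p q a b c where 1:
    "\<And>z. z \<in> S \<Longrightarrow> (v has_derivative (\<lambda>h. p z * Re h + q z * Im h)) (at z)"
    "\<And>z. z \<in> S \<Longrightarrow> (p has_derivative (\<lambda>h. a z * Re h + b z * Im h)) (at z)"
    "\<And>z. z \<in> S \<Longrightarrow> (q has_derivative (\<lambda>h. b z * Re h + c z * Im h)) (at z)"
    "\<And>z. z \<in> S \<Longrightarrow> a z + c z = 0"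
    using assms(2) unfolding harmonic_on_def by blast
  define w where "w z = v z + \<kappa> * (cmod z)\<^sup>2" for z
  have lim: "filterlim (\<lambda>x::real. z0 + of_real x * d) (nhds z0) (nhds 0)" for d
  proof -
    have "((\<lambda>x::real. z0 + of_real x * d) \<longlongrightarrow> z0 + of_real 0 * d) (nhds 0)"
      by (intro tendsto_intros filterlim_ident)
    then show ?thesis by simp
  qed
  have evS: "\<forall>\<^sub>F z in nhds z0. z \<in> S" using assms by (simp add: eventually_nhds_in_open)
  have line: "((\<lambda>x::real. z0 + of_real x * d) has_derivative (\<lambda>h. of_real h * d)) (at x)" for d x
    by (auto intro!: derivative_eq_intros)
  have sq: "((\<lambda>x. \<kappa> * (cmod (z0 + of_real x * d))\<^sup>2) has_real_derivative
      \<kappa> * (2 * Re d * Re (z0 + of_real x * d) + 2 * Im d * Im (z0 + of_real x * d))) (at x)" for d x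
    unfolding cmod_power2 by (auto intro!: derivative_eq_intros simp: algebra_simps)
  have kd: "\<forall>\<^sub>F x in nhds 0. ((\<lambda>x. w (z0 + of_real x * d)) has_real_derivative
      p (z0 + of_real x * d) * Re d + q (z0 + of_real x * d) * Im d
      + \<kappa> * (2 * Re d * Re (z0 + of_real x * d) + 2 * Im d * Im (z0 + of_real x * d))) (at x)" for d
    using eventually_compose_filterlim[OF evS lim[of d]]
  proof eventually_elim
    case (elim x)
    have "((\<lambda>x. v (z0 + of_real x * d)) has_real_derivative
      p (z0 + of_real x * d) * Re d + q (z0 + of_real x * d) * Im d) (at x)"
      using has_derivative_compose[OF line 1(1)[OF elim]]
      unfolding has_field_derivative_def
      by (rule has_derivative_eq_rhs) (auto simp: algebra_simps)
    from DERIV_add[OF this sq] show ?case unfolding w_def by simp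
  qed
  have maxd: "\<forall>\<^sub>F x in nhds 0. w (z0 + of_real x * d) \<le> w (z0 + of_real 0 * d)" for d
    using eventually_compose_filterlim[OF max lim[of d]] unfolding w_def by simp
  have dp: "((\<lambda>x. p (z0 + of_real x * d)) has_real_derivative a z0 * Re d + b z0 * Im d) (at 0)" for d
    using has_derivative_compose[OF line[of _ 0], of p "\<lambda>h. a z0 * Re h + b z0 * Im h" d] 1(2)[OF assms(3)]
    unfolding has_field_derivative_def
    by (auto elim!: has_derivative_eq_rhs simp: algebra_simps)
  have dq: "((\<lambda>x. q (z0 + of_real x * d)) has_real_derivative b z0 * Re d + c z0 * Im d) (at 0)" for d
    using has_derivative_compose[OF line[of _ 0], of q "\<lambda>h. b z0 * Re h + c z0 * Im h" d] 1(3)[OF assms(3)]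
    unfolding has_field_derivative_def
    by (auto elim!: has_derivative_eq_rhs simp: algebra_simps)
  have "a z0 + 2 * \<kappa> \<le> 0"
    by (rule second_derivative_nonpos_at_max[where k = "\<lambda>x. w (z0 + of_real x * 1)", OF kd _ maxd])
      (use dp[of 1] in \<open>auto intro!: derivative_eq_intros\<close>)
  moreover have "c z0 + 2 * \<kappa> \<le> 0"
    by (rule second_derivative_nonpos_at_max[where k = "\<lambda>x. w (z0 + of_real x * \<i>)", OF kd _ maxd])
      (use dq[of \<i>] in \<open>auto intro!: derivative_eq_intros\<close>)
  ultimately show False using 1(4)[OF assms(3)] assms(4) by linarith
qed

text \<open>If \<open>v z\<close> were positive, the set \<open>K\<close> where \<open>v\<close> is
  at least half of this value would be compact: the condition at points outside \<open>S\<close>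
  makes it closed, the one at infinity makes it bounded. Adding a small multiple of the squared
  modulus then produces a local maximum of the kind just excluded.\<close>

lemma harmonic_maximum_principle:
  assumes "open S" and harm: "harmonic_on v S"
    and bdry: "\<And>e p. e > 0 \<Longrightarrow> p \<notin> S \<Longrightarrow> \<forall>\<^sub>F z in at p within S. v z < e"
    and infty: "\<And>e. e > 0 \<Longrightarrow> \<exists>R. \<forall>z\<in>S. cmod z > R \<longrightarrow> v z < e"
    and "z \<in> S"
  shows "v z \<le> 0"
proof (rule ccontr)
  assume "\<not> v z \<le> 0"
  define e where "e = v z / 2"
  have e: "e > 0" using \<open>\<not> v z \<le> 0\<close> by (simp add: e_def)
  define K where "K = {z\<in>S. v z \<ge> e}"
  obtain R where R: "\<And>z. z \<in> S \<Longrightarrow> cmod z > R \<Longrightarrow> v z < e" using infty[OF e] by blast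
  have KR: "cmod z \<le> R" if "z \<in> K" for z
    using R that unfolding K_def by force
  have "closed K"
  proof -
    have "\<exists>T. open T \<and> x \<in> T \<and> T \<subseteq> - K" if x: "x \<in> - K" for x
    proof -
      have "\<forall>\<^sub>F z in nhds x. z \<notin> K"
      proof (cases "x \<in> S")
        case True
        then have "v x < e" using x by (auto simp: K_def)
        moreover have "filterlim v (nhds (v x)) (nhds x)"
          using harmonic_on_imp_continuous_at[OF harm True] by (simp add: continuous_at tendsto_at_iff_tendsto_nhds)
        ultimately have "\<forall>\<^sub>F z in nhds x. v z < e"
          by (simp add: order_tendstoD(2))
        then show ?thesis by eventually_elim (auto simp: K_def)
      next
        case False
        have "\<forall>\<^sub>F z in nhds x. z \<noteq> x \<longrightarrow> z \<in> S \<longrightarrow> v z < e"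
          using bdry[OF e False] by (simp add: eventually_at_filter)
        then show ?thesis by eventually_elim (use False in \<open>auto simp: K_def\<close>)
      qed
      then show ?thesis unfolding eventually_nhds by blast
    qed
    then have "open (- K)" by (subst open_subopen) blast
    then show ?thesis by (simp add: closed_def)
  qed
  moreover have "bounded K" using KR by (auto simp: bounded_iff)
  ultimately have "compact K" by (simp add: compact_eq_bounded_closed)
  have "z \<in> K" using \<open>z \<in> S\<close> e by (simp add: K_def e_def)
  \<comment> \<open>\<open>R1\<close> bounds the modulus of every point at distance less than 1 from
    \<open>K\<close>, and \<open>\<kappa>\<close> is chosen so that the added term is at most
    \<open>e\<close> at such points.\<close>
  define R1 where "R1 = \<bar>R\<bar> + 1"
  define \<kappa> where "\<kappa> = e / (R1)\<^sup>2"
  have R1: "R1 > 0" by (simp add: R1_def)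
  have \<kappa>: "\<kappa> > 0" using e R1 by (simp add: \<kappa>_def)
  define w where "w z = v z + \<kappa> * (cmod z)\<^sup>2" for z
  have "continuous_on K w" unfolding w_def
    using harmonic_on_imp_continuous_at[OF harm]
    by (intro continuous_intros continuous_at_imp_continuous_on) (auto simp: K_def)
  then obtain z0 where z0: "z0 \<in> K" "\<And>y. y \<in> K \<Longrightarrow> w y \<le> w z0"
    using continuous_attains_sup[OF \<open>compact K\<close>] \<open>z \<in> K\<close> by blast
  have z0S: "z0 \<in> S" using z0 by (auto simp: K_def)
  \<comment> \<open>Nearby points of \<open>S\<close> outside \<open>K\<close> satisfy w < e + e, so
    this bound makes the maximum over \<open>K\<close> a local maximum in \<open>S\<close>.\<close>
  have big: "2 * e \<le> w z0"
    using z0(2)[OF \<open>z \<in> K\<close>] \<kappa> by (auto simp: w_def e_def intro: order_trans[rotated])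
  have "\<forall>\<^sub>F y in nhds z0. y \<in> S \<inter> ball z0 1"
    using z0S assms(1) by (intro eventually_nhds_in_open) auto
  then have "\<forall>\<^sub>F y in nhds z0. w y \<le> w z0"
  proof eventually_elim
    case (elim y)
    show ?case
    proof (cases "y \<in> K")
      case False
      then have "v y < e" using elim by (auto simp: K_def)
      have "cmod y \<le> R1"
        using KR[OF z0(1)] elim norm_triangle_ineq[of z0 "y - z0"]
        by (auto simp: R1_def dist_norm norm_minus_commute)
      then have "\<kappa> * (cmod y)\<^sup>2 \<le> \<kappa> * R1\<^sup>2"
        using \<kappa> by (intro mult_left_mono power_mono) auto
      also have "\<dots> = e" using R1 by (simp add: \<kappa>_def)
      finally show ?thesis using \<open>v y < e\<close> big by (simp add: w_def)
    qed (use z0 in auto)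
  qed
  then show False
    using no_local_max_harmonic_plus_square[OF assms(1) harm z0S \<kappa>] unfolding w_def by blast
qed

section \<open>Exceptional boundary points in the maximum principle\<close>

lemma tendsto_neg_norm_ln_at_top:
  fixes b :: complex
  shows "filterlim (\<lambda>z. - ln (cmod (z - b))) at_top (at b within S)"
proof -
  have "((\<lambda>z. cmod (z - b)) \<longlongrightarrow> 0) (at b within S)"
    by (auto intro!: tendsto_eq_intros)
  moreover have "\<forall>\<^sub>F z in at b within S. cmod (z - b) \<in> {0<..} \<and> cmod (z - b) \<noteq> 0"
    by (auto simp: eventually_at_filter)
  ultimately have "filterlim (\<lambda>z. cmod (z - b)) (at_right 0) (at b within S)"
    unfolding filterlim_at by auto
  then have "filterlim (\<lambda>z. ln (cmod (z - b))) at_bot (at b within S)"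
    using filterlim_compose[OF ln_at_0] by blast
  then show ?thesis by (simp add: filterlim_uminus_at_bot)
qed

text \<open>The exceptional boundary points are dealt with by a small multiple of a positive harmonic
  function with logarithmic poles there and at infinity.\<close>

lemma harmonic_maximum_principle_except:
  assumes "open S" and SH: "S \<subseteq> upper_half_plane" and "b \<notin> S" and harm: "harmonic_on v S"
    and bdd: "\<And>z. z \<in> S \<Longrightarrow> v z \<le> M"
    and bdry: "\<And>e p. e > 0 \<Longrightarrow> p \<notin> S \<Longrightarrow> p \<noteq> 0 \<Longrightarrow> p \<noteq> b \<Longrightarrow> \<forall>\<^sub>F z in at p within S. v z < e"
    and z: "z \<in> S"
  shows "v z \<le> 0"
proof -
  define l where "l z = ln (cmod (z - (- \<i>)))" for z
  define l0 where "l0 z = ln (cmod (z - 0))" for z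
  define lb where "lb z = ln (cmod (z - b))" for z
  \<comment> \<open>The reference point - \<i> lies below the half-plane, so |z + \<i>| is at least
    1 and at least |z|; the constant compensates for |z - b| \<le> |z + \<i>| (1 + |b|). Hence
    \<open>l\<close>, \<open>l - l0\<close> and \<open>l - lb\<close> plus the constant are all
    nonnegative on \<open>S\<close>, and \<open>B\<close> dominates each of \<open>l\<close>,
    \<open>- l0\<close> and \<open>- lb\<close>.\<close>
  define B where "B z = l z + (l z - l0 z) + (l z - lb z) + ln (1 + cmod b)" for z
  have ge1: "1 \<le> cmod (z - (- \<i>))" and gez: "cmod (z - 0) \<le> cmod (z - (- \<i>))" and z0: "z \<noteq> 0"
    and geb: "cmod (z - b) \<le> cmod (z - (- \<i>)) * (1 + cmod b)" and zi: "z \<noteq> - \<i>" if "z \<in> S" for z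
  proof -
    have Im: "Im z > 0" using that SH by (auto simp: upper_half_plane_def)
    then show "z \<noteq> 0" "z \<noteq> - \<i>" by auto
    show "1 \<le> cmod (z - (- \<i>))" using abs_Im_le_cmod[of "z - (- \<i>)"] Im by simp
    show 2: "cmod (z - 0) \<le> cmod (z - (- \<i>))"
      using Im by (simp add: cmod_def power2_eq_square algebra_simps)
    have "cmod (z - b) \<le> cmod z + 1 * cmod b" using norm_triangle_ineq4[of z b] by simp
    also have "\<dots> \<le> cmod (z - (- \<i>)) + cmod (z - (- \<i>)) * cmod b"
      using 2 \<open>1 \<le> cmod (z - (- \<i>))\<close> by (intro add_mono mult_right_mono) auto
    finally show "cmod (z - b) \<le> cmod (z - (- \<i>)) * (1 + cmod b)" by (simp add: algebra_simps)
  qed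
  have l_nonneg: "0 \<le> l z" and l_ge0: "0 \<le> l z - l0 z" and l_geb: "0 \<le> l z - lb z + ln (1 + cmod b)"
    if "z \<in> S" for z
  proof -
    show "0 \<le> l z" using ge1[OF that] by (simp add: l_def)
    show "0 \<le> l z - l0 z" unfolding l_def l0_def
      using ln_mono[OF gez[OF that]] z0[OF that] zi[OF that] by (auto simp: eq_neg_iff_add_eq_0)
    have "z \<noteq> b" using that \<open>b \<notin> S\<close> by auto
    then have "lb z \<le> ln (cmod (z - (- \<i>)) * (1 + cmod b))"
      unfolding lb_def using geb[OF that] zi[OF that] by (subst ln_le_cancel_iff) (auto intro!: mult_pos_pos simp: add_pos_nonneg)
    also have "\<dots> = l z + ln (1 + cmod b)"
      unfolding l_def using ge1[OF that] by (subst ln_mult_pos) (auto simp: add_pos_nonneg)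
    finally show "0 \<le> l z - lb z + ln (1 + cmod b)" by simp
  qed
  have Bl: "l z \<le> B z" and B0: "- l0 z \<le> B z" and Bb: "- lb z \<le> B z" and Bpos: "0 \<le> B z" if "z \<in> S" for z
  proof -
    have "0 \<le> ln (1 + cmod b)" by simp
    with l_nonneg[OF that] l_ge0[OF that] l_geb[OF that]
    show "l z \<le> B z" "- l0 z \<le> B z" "- lb z \<le> B z" "0 \<le> B z"
      unfolding B_def by linarith+
  qed
  have "- \<i> \<notin> S" "0 \<notin> S" using z0 zi by auto
  then have "harmonic_on B S"
    unfolding B_def l_def l0_def lb_def
    using assms(1,3)
    by (intro harmonic_on_add harmonic_on_diff harmonic_on_const harmonic_on_ln_norm) auto
  have main: "v z - d * B z \<le> 0" if d: "d > 0" for d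
  proof (rule harmonic_maximum_principle[OF assms(1) _ _ _ z])
    show "harmonic_on (\<lambda>z. v z - d * B z) S"
      by (intro harmonic_on_diff harmonic_on_cmult) fact+
    fix e :: real assume e: "e > 0"
    \<comment> \<open>Where \<open>B\<close> reaches M / d, the bound v \<le> M already suffices.
      This settles the points 0 and \<open>b\<close> and infinity at once.\<close>
    have small: "v z - d * B z < e" if "z \<in> S" "B z \<ge> M / d" for z
      using bdd[OF that(1)] that(2) d e by (simp add: field_simps)
    show "\<exists>R. \<forall>z\<in>S. cmod z > R \<longrightarrow> v z - d * B z < e"
    proof (intro exI ballI impI small)
      fix z assume "z \<in> S" "cmod z > exp (M / d)"
      then have "cmod (z - (- \<i>)) \<ge> exp (M / d)" using gez[of z] by auto
      then have "l z \<ge> M / d" unfolding l_def by (meson exp_gt_zero ln_ge_iff less_le_trans)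
      then show "B z \<ge> M / d" using Bl[OF \<open>z \<in> S\<close>] by linarith
    qed
    fix p assume p: "p \<notin> S"
    have S: "\<forall>\<^sub>F z in at p within S. z \<in> S" by (simp add: eventually_at_filter)
    consider "p = 0" | "p = b" | "p \<noteq> 0" "p \<noteq> b" by blast
    then show "\<forall>\<^sub>F z in at p within S. v z - d * B z < e"
    proof cases
      case 1
      have "\<forall>\<^sub>F z in at p within S. - l0 z \<ge> M / d"
        using tendsto_neg_norm_ln_at_top[of p S] unfolding l0_def 1 filterlim_at_top by blast
      with S show ?thesis
        by eventually_elim (use B0 in \<open>auto intro!: small intro: order_trans\<close>)
    next
      case 2
      have "\<forall>\<^sub>F z in at p within S. - lb z \<ge> M / d"
        using tendsto_neg_norm_ln_at_top[of p S] unfolding lb_def 2 filterlim_at_top by blast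
      with S show ?thesis
        by eventually_elim (use Bb in \<open>auto intro!: small intro: order_trans\<close>)
    next
      case 3
      from S bdry[OF e p 3] show ?thesis
      proof eventually_elim
        case (elim z)
        have "0 \<le> d * B z" using d Bpos[OF elim(1)] by simp
        then show ?case using elim by linarith
      qed
    qed
  qed
  \<comment> \<open>The point \<open>z\<close> is fixed, so the auxiliary function disappears as
    \<open>d\<close> tends to 0.\<close>
  have "((\<lambda>d. v z - d * B z) \<longlongrightarrow> v z - 0 * B z) (at_right 0)"
    by (intro tendsto_intros)
  moreover have "\<forall>\<^sub>F d in at_right 0. v z - d * B z \<le> 0"
    using main by (simp add: eventually_at_filter)
  ultimately show ?thesis
    using tendsto_upperbound by fastforce
qed

section \<open>Slits that are Lipschitz graphs\<close>

lemma at_within_le_if_eventually: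
  assumes "\<forall>\<^sub>F z in nhds x. z \<in> A \<longrightarrow> z \<in> B"
  shows "at x within A \<le> at x within B"
proof (rule filter_leI)
  fix P assume "eventually P (at x within B)"
  then have "\<forall>\<^sub>F z in nhds x. z \<noteq> x \<longrightarrow> z \<in> B \<longrightarrow> P z" by (simp add: eventually_at_filter)
  with assms have "\<forall>\<^sub>F z in nhds x. z \<noteq> x \<longrightarrow> z \<in> A \<longrightarrow> P z" by eventually_elim auto
  then show "eventually P (at x within A)" by (simp add: eventually_at_filter)
qed

text \<open>Rotation by - \<i> brings \<open>w\<close> into the right half-plane, where the argument
  is the arctangent of the slope, and |arctan x| \<le> |x|.\<close>

lemma Im_Ln_near_pi_half:
  assumes "Im w > 0" "\<bar>Re w\<bar> \<le> e * Im w"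
  shows "\<bar>Im (Ln w) - pi / 2\<bar> \<le> e"
proof -
  have nz: "-\<i> * w \<noteq> 0" using assms by auto
  have "Ln (\<i> * (-\<i> * w)) = Ln (-\<i> * w) + \<i> * of_real pi / 2"
    using assms by (subst Ln_times_ii[OF nz]) auto
  then have "Im (Ln w) = Im (Ln (-\<i> * w)) + pi / 2" by simp
  also have "Im (Ln (-\<i> * w)) = arctan (- Re w / Im w)"
    using assms by (subst Im_Ln_eq[OF nz]) auto
  finally have "\<bar>Im (Ln w) - pi / 2\<bar> \<le> \<bar>Re w / Im w\<bar>"
    using abs_arctan_le[of "- Re w / Im w"] by simp
  also have "\<dots> \<le> e" using assms by (simp add: abs_divide divide_le_eq)
  finally show ?thesis .
qed

lemma Im_Ln_near_minus_pi_half: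
  assumes "Im w < 0" "\<bar>Re w\<bar> \<le> e * - Im w"
  shows "\<bar>Im (Ln w) + pi / 2\<bar> \<le> e"
proof -
  have "w \<notin> \<real>\<^sub>\<le>\<^sub>0" using assms by (simp add: complex_nonpos_Reals_iff)
  then have "Ln (cnj w) = cnj (Ln w)" using cnj_Ln by metis
  then have "Im (Ln (cnj w)) = - Im (Ln w)" by (metis cnj.sel(2))
  moreover have "\<bar>Im (Ln (cnj w)) - pi / 2\<bar> \<le> e"
    using assms by (intro Im_Ln_near_pi_half) simp_all
  ultimately show ?thesis by linarith
qed

lemma Ln_times_Re_pos:
  assumes "0 < Re a" "0 < Re b"
  shows "Ln (a * b) = Ln a + Ln b"
  using assms Re_Ln_pos_lt_imp[of a] Re_Ln_pos_lt_imp[of b] by (subst Ln_times_simple) auto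

text \<open>The point lies on the branch cut, but in the upper half-plane Ln z = Ln (- z) + \<i> pi,
  and the right-hand side is continuous there.\<close>

lemma tendsto_Ln_negative_real:
  assumes "x < 0"
  shows "(Ln \<longlongrightarrow> Ln (- of_real x) + \<i> * pi) (at (of_real x) within upper_half_plane)"
proof (rule Lim_transform_eventually)
  have "- complex_of_real x \<notin> \<real>\<^sub>\<le>\<^sub>0" using assms by (simp add: complex_nonpos_Reals_iff)
  then show "((\<lambda>z. Ln (- z) + \<i> * pi) \<longlongrightarrow> Ln (- of_real x) + \<i> * pi) (at (of_real x) within upper_half_plane)"
    by (intro tendsto_intros)
  have "Ln (- z) + \<i> * pi = Ln z" if "Im z > 0" for z
    using that by (subst Ln_minus) auto
  then show "\<forall>\<^sub>F z in at (of_real x) within upper_half_plane. Ln (- z) + \<i> * pi = Ln z"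
    by (auto simp: eventually_at_filter upper_half_plane_def)
qed

text \<open>The hypotheses say (P + \<i> Q)^2 = (X + \<i> Y)^2 + h^2. Eliminating \<open>P\<close>
  gives the last identity, and comparing its two sides yields 0 \<le> Y^2 - Q^2 \<le> h^2, from
  which the other two bounds follow.\<close>

lemma Im_square_root_bounds:
  fixes X Y Q P h :: real
  assumes h: "h \<ge> 0" and 1: "P\<^sup>2 - Q\<^sup>2 = X\<^sup>2 - Y\<^sup>2 + h\<^sup>2" and 2: "P * Q = X * Y" and Y: "Y \<ge> 0"
  shows "\<bar>Q\<bar> \<le> Y" and "Q > 0 \<Longrightarrow> Y - Q \<le> h" and "Q \<noteq> 0 \<Longrightarrow> (Y\<^sup>2 - Q\<^sup>2) * (Q\<^sup>2 + X\<^sup>2) = h\<^sup>2 * Q\<^sup>2"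
proof -
  have "P\<^sup>2 * Q\<^sup>2 = X\<^sup>2 * Y\<^sup>2" using 2 by (metis power_mult_distrib)
  then have "(X\<^sup>2 - Y\<^sup>2 + h\<^sup>2 + Q\<^sup>2) * Q\<^sup>2 = X\<^sup>2 * Y\<^sup>2" using 1 by (metis diff_add_cancel)
  then show eq: "(Y\<^sup>2 - Q\<^sup>2) * (Q\<^sup>2 + X\<^sup>2) = h\<^sup>2 * Q\<^sup>2" by algebra
  have le: "Q\<^sup>2 \<le> Y\<^sup>2 \<and> Y\<^sup>2 - Q\<^sup>2 \<le> h\<^sup>2"
  proof (cases "Q = 0")
    \<comment> \<open>Here Q^2 + X^2 may vanish and cannot be divided out; if X = 0, then Y^2 = h^2
      - P^2, and the case Y = 0 is immediate.\<close>
    case True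
    then have "X = 0 \<or> Y = 0" using 2 by auto
    then show ?thesis using 1 True by (cases "X = 0") (auto simp: Y, (smt (verit) zero_le_power2)+)
  next
    case False
    then have pos: "Q\<^sup>2 + X\<^sup>2 > 0" by (simp add: sum_power2_gt_zero_iff)
    have "0 \<le> (Y\<^sup>2 - Q\<^sup>2) * (Q\<^sup>2 + X\<^sup>2)" using eq by simp
    then have "0 \<le> Y\<^sup>2 - Q\<^sup>2" using pos by (simp add: zero_le_mult_iff)
    moreover have "(Y\<^sup>2 - Q\<^sup>2) * (Q\<^sup>2 + X\<^sup>2) \<le> h\<^sup>2 * (Q\<^sup>2 + X\<^sup>2)"
      unfolding eq by (intro mult_left_mono) auto
    then have "Y\<^sup>2 - Q\<^sup>2 \<le> h\<^sup>2" using pos by simp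
    ultimately show ?thesis by simp
  qed
  then show "\<bar>Q\<bar> \<le> Y" using Y abs_le_square_iff[of Q Y] by simp
  then show "Y - Q \<le> h" if "Q > 0"
  proof -
    have "(Y - Q)\<^sup>2 \<le> Y\<^sup>2 - Q\<^sup>2"
      using \<open>\<bar>Q\<bar> \<le> Y\<close> that mult_nonneg_nonneg[of Q "Y - Q"] by (simp add: power2_eq_square algebra_simps)
    then have "(Y - Q)\<^sup>2 \<le> h\<^sup>2" using le by linarith
    then show ?thesis using h by (simp add: power2_le_iff_abs_le)
  qed
qed

section \<open>The geometry of a slit that is a graph over the vertical axis\<close>

text \<open>The function \<open>g\<close> lives on the whole line so that left and right of the
  graph make sense at every height, also above the tip. The bound \<epsilon> \<le> 1 keeps the slit
  in the cone |Re z| \<le> Im z.\<close>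

locale graph_slit =
  fixes g :: "real \<Rightarrow> real" and h \<epsilon> :: real
  assumes h_pos: "0 < h" and eps: "0 \<le> \<epsilon>" "\<epsilon> \<le> 1"
    and lipschitz: "\<bar>g x - g y\<bar> \<le> \<epsilon> * \<bar>x - y\<bar>"
    and g_0: "g 0 = 0" and g_above: "y \<ge> h \<Longrightarrow> g y = g h"
begin

definition slit where "slit = {z. 0 \<le> Im z \<and> Im z \<le> h \<and> Re z = g (Im z)}"
definition dom where "dom = upper_half_plane - slit"
definition tip where "tip = Complex (g h) h"
definition right where "right = {z. 0 < Im z \<and> g (Im z) < Re z}"
definition left where "left = {z. 0 < Im z \<and> Re z < g (Im z)}"
text \<open>The first set avoids the horizontal ray from the tip to the left and the second the ray
  to the right. These rays are the cuts of Ln (z - tip) and of Ln (tip - z). Together the two open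
  sets cover the slit domain, overlapping above the tip.\<close>

definition right_or_above where "right_or_above = {z. 0 < Im z \<and> (h < Im z \<or> g (Im z) < Re z)}"
definition left_or_above where "left_or_above = {z. 0 < Im z \<and> (h < Im z \<or> Re z < g (Im z))}"

lemma g_bound: "\<bar>g y\<bar> \<le> \<epsilon> * \<bar>y\<bar>"
  using lipschitz[of y 0] g_0 by simp

lemma tip_simps [simp]: "Re tip = g h" "Im tip = h"
  by (simp_all add: tip_def)

lemma tip_not_in_dom: "tip \<notin> dom"
  using h_pos by (simp add: dom_def slit_def upper_half_plane_def)

lemma dom_eq: "dom = right_or_above \<union> left_or_above"
  by (auto simp: dom_def slit_def upper_half_plane_def right_or_above_def left_or_above_def)

lemma right_subset: "right \<subseteq> right_or_above" and left_subset: "left \<subseteq> left_or_above"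
  by (auto simp: right_def right_or_above_def left_def left_or_above_def)

lemma dom_subset: "dom \<subseteq> upper_half_plane"
  by (auto simp: dom_def)

lemma continuous_g: "continuous_on S g"
proof -
  have "\<epsilon>-lipschitz_on S g"
    using lipschitz eps by (auto intro!: lipschitz_onI simp: dist_real_def)
  then show ?thesis by (rule lipschitz_on_continuous_on)
qed

lemma continuous_g_Im: "continuous_on UNIV (\<lambda>z. g (Im z))"
  by (rule continuous_on_compose2[OF continuous_g[of UNIV]]) (auto intro!: continuous_intros)

lemma open_right_or_above: "open right_or_above" and open_left_or_above: "open left_or_above"
  unfolding right_or_above_def left_or_above_def
  by (intro open_Collect_conj open_Collect_disj open_Collect_less continuous_g_Im continuous_intros)+

lemma open_dom: "open dom"
  unfolding dom_eq using open_right_or_above open_left_or_above by blast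

section \<open>A branch of the logarithm cut along the slit\<close>

lemma not_nonpos_right: "z \<in> right_or_above \<Longrightarrow> z - tip \<notin> \<real>\<^sub>\<le>\<^sub>0"
  and not_nonpos_left: "z \<in> left_or_above \<Longrightarrow> tip - z \<notin> \<real>\<^sub>\<le>\<^sub>0"
  by (auto simp: right_or_above_def left_or_above_def complex_nonpos_Reals_iff)

text \<open>A branch of log (z - tip) on the slit domain: above the tip, where the two pieces meet,
  Ln (z - tip) = Ln (tip - z) + \<i> pi. The argument grows by 2 pi on the way over the tip from the
  right side of the slit to the left one, and this jump is what tells the two sides apart.\<close>

definition log_tip where
  "log_tip z = (if z \<in> right_or_above then Ln (z - tip) else Ln (tip - z) + \<i> * pi)"

lemma log_tip_right: "z \<in> right_or_above \<Longrightarrow> log_tip z = Ln (z - tip)"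
  by (simp add: log_tip_def)

lemma log_tip_left:
  assumes "z \<in> left_or_above"
  shows "log_tip z = Ln (tip - z) + \<i> * pi"
proof (cases "z \<in> right_or_above")
  case True
  then have "Im z > h" using assms by (auto simp: right_or_above_def left_or_above_def)
  then have "Ln (- (z - tip)) = Ln (z - tip) - \<i> * pi"
    by (subst Ln_minus) auto
  then show ?thesis using True by (simp add: log_tip_def)
qed (simp add: log_tip_def)

lemma exp_log_tip: "z \<in> dom \<Longrightarrow> exp (log_tip z) = z - tip"
  using tip_not_in_dom by (cases "z = tip") (auto simp: log_tip_def exp_add exp_pi_i')

lemma log_tip_deriv:
  assumes "z \<in> dom"
  shows "(log_tip has_field_derivative 1 / (z - tip)) (at z)"
proof (cases "z \<in> right_or_above")
  case True
  have "((\<lambda>z. Ln (z - tip)) has_field_derivative 1 / (z - tip)) (at z)"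
    using not_nonpos_right[OF True] by (auto intro!: derivative_eq_intros simp: divide_inverse)
  then show ?thesis
    by (rule has_field_derivative_transform_within_open[OF _ open_right_or_above True]) (simp add: log_tip_right)
next
  case False
  then have l: "z \<in> left_or_above" using assms dom_eq by auto
  have "((\<lambda>z. Ln (tip - z) + \<i> * pi) has_field_derivative 1 / (z - tip)) (at z)"
    using not_nonpos_left[OF l] by (auto intro!: derivative_eq_intros simp: divide_simps)
  then show ?thesis
    by (rule has_field_derivative_transform_within_open[OF _ open_left_or_above l]) (simp add: log_tip_left)
qed

lemma Im_log_tip_bound: "\<bar>Im (log_tip z)\<bar> \<le> 2 * pi" if "z \<in> dom"
  using that tip_not_in_dom mpi_less_Im_Ln[of "z - tip"] Im_Ln_le_pi[of "z - tip"]
    mpi_less_Im_Ln[of "tip - z"] Im_Ln_le_pi[of "tip - z"]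
  by (cases "z = tip") (auto simp: log_tip_def)

text \<open>For the straight slit this is the difference of the harmonic measures of the right and the
  left side: \<open>(z\<^sup>2 + h\<^sup>2) / z\<^sup>2\<close> is negative exactly on the slit and its mirror image.\<close>

definition angle where
  "angle z = - (1 / pi) * Im (log_tip z + Ln (z - cnj tip) - 2 * Ln z)"

text \<open>The square root maps the complement of the straight slit conformally onto the half-plane.\<close>

definition height where
  "height z = Im (z - exp ((log_tip z + Ln (z - cnj tip)) / 2))"

section \<open>Harmonicity and size of the two comparison functions\<close>

lemma Im_minus_cnj_tip: "z \<in> dom \<Longrightarrow> Im (z - cnj tip) > h"
  using dom_subset by (auto simp: upper_half_plane_def)

lemma Ln_minus_cnj_tip_deriv:
  assumes "z \<in> dom"
  shows "((\<lambda>z. Ln (z - cnj tip)) has_field_derivative 1 / (z - cnj tip)) (at z)"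
proof -
  have "z - cnj tip \<notin> \<real>\<^sub>\<le>\<^sub>0"
    using Im_minus_cnj_tip[OF assms] h_pos by (simp add: complex_nonpos_Reals_iff)
  then show ?thesis by (auto intro!: derivative_eq_intros simp: divide_inverse)
qed

lemma harmonic_angle: "harmonic_on angle dom"
  unfolding angle_def
proof (intro harmonic_on_cmult harmonic_on_Im[OF open_dom])
  fix z assume z: "z \<in> dom"
  then have "Im z > 0" using dom_subset by (auto simp: upper_half_plane_def)
  then have "(Ln has_field_derivative 1 / z) (at z)"
    using has_field_derivative_Ln[of z] by (simp add: complex_nonpos_Reals_iff divide_inverse)
  from DERIV_diff[OF DERIV_add[OF log_tip_deriv[OF z] Ln_minus_cnj_tip_deriv[OF z]] DERIV_cmult[OF this, of 2]]
  show "((\<lambda>z. log_tip z + Ln (z - cnj tip) - 2 * Ln z) has_field_derivative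
      1 / (z - tip) + 1 / (z - cnj tip) - 2 * (1 / z)) (at z)" .
qed

lemma harmonic_height: "harmonic_on height dom"
  unfolding height_def
proof (intro harmonic_on_Im[OF open_dom])
  fix z assume z: "z \<in> dom"
  show "((\<lambda>z. z - exp ((log_tip z + Ln (z - cnj tip)) / 2)) has_field_derivative
      1 - exp ((log_tip z + Ln (z - cnj tip)) / 2) * ((1 / (z - tip) + 1 / (z - cnj tip)) / 2)) (at z)"
    using DERIV_add[OF log_tip_deriv[OF z] Ln_minus_cnj_tip_deriv[OF z]]
    by (intro DERIV_diff DERIV_ident DERIV_fun_exp DERIV_cdivide)
qed

lemma angle_bounded: "\<bar>angle z\<bar> \<le> 5" if "z \<in> dom"
proof -
  have z: "z \<noteq> 0" "z - cnj tip \<noteq> 0"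
    using that Im_minus_cnj_tip[OF that] h_pos dom_subset by (auto simp: upper_half_plane_def)
  have "\<bar>Im (log_tip z + Ln (z - cnj tip) - 2 * Ln z)\<bar> \<le> 5 * pi"
    using Im_log_tip_bound[OF that] mpi_less_Im_Ln[OF z(1)] Im_Ln_le_pi[OF z(1)]
      mpi_less_Im_Ln[OF z(2)] Im_Ln_le_pi[OF z(2)] by (simp add: abs_le_iff)
  then show ?thesis unfolding angle_def by (simp add: abs_mult field_simps)
qed

text \<open>\<open>q\<close> is a square root of (z - tip) (z - cnj tip) = (z - g h)^2 + h^2, so its
  real and imaginary parts satisfy the hypotheses of \<open>Im_square_root_bounds\<close> with X =
  Re z - g h and Y = Im z. Above the tip both logarithms have arguments between 0 and pi, which puts
  \<open>q\<close> in the upper half-plane.\<close>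

lemma height_algebra:
  assumes z: "z \<in> dom"
  defines "q \<equiv> exp ((log_tip z + Ln (z - cnj tip)) / 2)"
  shows "(Re q)\<^sup>2 - (Im q)\<^sup>2 = (Re z - g h)\<^sup>2 - (Im z)\<^sup>2 + h\<^sup>2"
    and "Re q * Im q = (Re z - g h) * Im z"
    and "h < Im z \<Longrightarrow> Im q > 0"
    and "0 < Im z"
    and "height z = Im z - Im q"
proof -
  have nz: "z - cnj tip \<noteq> 0" using Im_minus_cnj_tip[OF z] h_pos by auto
  have "q\<^sup>2 = exp (2 * ((log_tip z + Ln (z - cnj tip)) / 2))" unfolding q_def by (subst exp_double) simp
  also have "\<dots> = exp (log_tip z + Ln (z - cnj tip))"
    by (rule arg_cong[where f = exp]) simp
  also have "\<dots> = (z - tip) * (z - cnj tip)"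
    using nz exp_log_tip[OF z] by (simp add: exp_add)
  finally have q2: "q\<^sup>2 = (z - tip) * (z - cnj tip)" .
  from arg_cong[OF q2, of Re] show "(Re q)\<^sup>2 - (Im q)\<^sup>2 = (Re z - g h)\<^sup>2 - (Im z)\<^sup>2 + h\<^sup>2"
    by (simp add: power2_eq_square algebra_simps)
  from arg_cong[OF q2, of Im] show "Re q * Im q = (Re z - g h) * Im z"
    by (simp add: power2_eq_square algebra_simps)
  show "0 < Im z" using z dom_subset by (auto simp: upper_half_plane_def)
  show "height z = Im z - Im q" by (simp add: height_def q_def)
  show "Im q > 0" if "h < Im z"
  proof -
    have "z \<in> right_or_above" using that h_pos by (simp add: right_or_above_def)
    then have "Im ((log_tip z + Ln (z - cnj tip)) / 2) = (Im (Ln (z - tip)) + Im (Ln (z - cnj tip))) / 2"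
      by (simp add: log_tip_right)
    moreover have "0 < Im (Ln (z - tip)) \<and> Im (Ln (z - tip)) < pi"
      using that by (intro Im_Ln_pos_lt_imp) simp
    moreover have "0 < Im (Ln (z - cnj tip)) \<and> Im (Ln (z - cnj tip)) < pi"
      using Im_minus_cnj_tip[OF z] h_pos by (intro Im_Ln_pos_lt_imp) simp
    ultimately show ?thesis unfolding q_def Im_exp by (intro mult_pos_pos sin_gt_zero) auto
  qed
qed

text \<open>Above the tip the square root loses at most \<open>h\<close> of the imaginary part. At
  heights up to \<open>h\<close> the bound |Im q| \<le> Im z gives at most 2 Im z, whatever the sign
  of Im q.\<close>

lemma height_le: "height z \<le> 2 * h" if z: "z \<in> dom"
proof (cases "h < Im z")
  case True
  show ?thesis
    using Im_square_root_bounds(2)[OF _ height_algebra(1,2)[OF z]] height_algebra(3-5)[OF z] True h_pos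
    by fastforce
next
  case False
  then show ?thesis
    using Im_square_root_bounds(1)[OF _ height_algebra(1,2)[OF z]] height_algebra(4,5)[OF z] h_pos
    by fastforce
qed

text \<open>Near \<i> one has |X| \<le> 3/8 < 5/8 \<le> Q, so in the identity (Y^2 - Q^2) (Q^2 +
  X^2) = h^2 Q^2 the second factor is at most 2 Q^2, and Y^2 - Q^2 is at least h^2 / 2.\<close>

lemma height_near_i:
  assumes "cmod (z - \<i>) \<le> 1/4" "h \<le> 1/8"
  shows "z \<in> dom" "h\<^sup>2 / 36 \<le> height z"
proof -
  have "\<bar>Re z\<bar> \<le> 1/4" "\<bar>Im z - 1\<bar> \<le> 1/4"
    using abs_Re_le_cmod[of "z - \<i>"] abs_Im_le_cmod[of "z - \<i>"] assms by auto
  then have z: "\<bar>Re z\<bar> \<le> 1/4" "3/4 \<le> Im z" "Im z \<le> 5/4" by linarith+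
  then show dom: "z \<in> dom" using assms(2) by (auto simp: dom_def slit_def upper_half_plane_def)
  define X where "X = Re z - g h"
  define Y where "Y = Im z"
  define q where "q = exp ((log_tip z + Ln (z - cnj tip)) / 2)"
  define Q where "Q = Im q"
  note alg = height_algebra[OF dom, folded q_def, folded X_def Y_def Q_def]
  have Q: "Q > 0" "Q \<le> Y" "Y - Q \<le> h"
    using alg(3,4) z assms(2) Im_square_root_bounds(1,2)[OF _ alg(1,2)] h_pos by (auto simp: Y_def)
  have eq: "(Y\<^sup>2 - Q\<^sup>2) * (Q\<^sup>2 + X\<^sup>2) = h\<^sup>2 * Q\<^sup>2"
    using Im_square_root_bounds(3)[OF _ alg(1,2)] Q(1) alg(4) h_pos by auto
  have Qge: "Q \<ge> 5/8" using Q(3) z assms(2) by (simp add: Y_def)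
  have "\<bar>g h\<bar> \<le> \<epsilon> * h" using g_bound[of h] h_pos by simp
  also have "\<dots> \<le> 1 * (1/8)" using eps h_pos assms(2) by (intro mult_mono) auto
  finally have "\<bar>X\<bar> \<le> 3/8" using z(1) unfolding X_def by linarith
  then have "X\<^sup>2 \<le> Q\<^sup>2" using Qge by (simp add: abs_le_square_iff[symmetric])
  then have "(Y\<^sup>2 - Q\<^sup>2) * (Q\<^sup>2 + X\<^sup>2) \<le> (Y\<^sup>2 - Q\<^sup>2) * (2 * Q\<^sup>2)"
    using Q by (intro mult_left_mono) (auto simp: power_mono)
  then have "h\<^sup>2 * Q\<^sup>2 \<le> (2 * (Y\<^sup>2 - Q\<^sup>2)) * Q\<^sup>2" using eq by (simp add: algebra_simps)
  then have 1: "h\<^sup>2 \<le> 2 * (Y\<^sup>2 - Q\<^sup>2)" using Q(1) by (simp add: mult_le_cancel_right)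
  have "2 * (Y\<^sup>2 - Q\<^sup>2) = (Y - Q) * (2 * (Y + Q))" by (simp add: power2_eq_square algebra_simps)
  \<comment> \<open>Here 2 (Y + Q) is at most 5, so the constant 36 is generous.\<close>
  also have "\<dots> \<le> (Y - Q) * 36" using Q z by (intro mult_left_mono) (auto simp: Y_def)
  finally show "h\<^sup>2 / 36 \<le> height z" using 1 alg(5) by simp
qed

lemma cmod_tip_le: "cmod tip \<le> 2 * h"
proof -
  have "\<bar>g h\<bar> \<le> \<epsilon> * h" using g_bound[of h] h_pos by simp
  also have "\<dots> \<le> 1 * h" using eps h_pos by (intro mult_right_mono) auto
  finally show ?thesis using cmod_le[of tip] h_pos by simp
qed

text \<open>The three logarithms combine to log ((1 - tip / z) (1 - cnj tip / z)). Its first order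
  term contains only tip + cnj tip = 2 g h, which is at most 2 \<epsilon> h; the imaginary part of
  the tip enters only at second order.\<close>

lemma angle_near_i:
  assumes "cmod (z - \<i>) \<le> 1/4" "h \<le> 1/16"
  shows "\<bar>angle z\<bar> \<le> 4 * \<epsilon> * h + 16 * h\<^sup>2"
proof -
  have "\<bar>Re z\<bar> \<le> 1/4" "\<bar>Im z - 1\<bar> \<le> 1/4"
    using abs_Re_le_cmod[of "z - \<i>"] abs_Im_le_cmod[of "z - \<i>"] assms by auto
  then have z: "\<bar>Re z\<bar> \<le> 1/4" "3/4 \<le> Im z" by linarith+
  then have nz: "z \<noteq> 0" and cz: "3/4 \<le> cmod z" using abs_Im_le_cmod[of z] by auto
  have small: "cmod (w / z) < 1" if "cmod w \<le> 2 * h" for w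
  proof -
    have "cmod w < cmod z" using that assms(2) cz by linarith
    then show ?thesis using cz nz by (simp add: norm_divide)
  qed
  \<comment> \<open>Both arguments lie between 0 and pi, so their difference stays in the range of
    the principal branch.\<close>
  have Ln_div: "Ln (z - w) - Ln z = Ln (1 - w / z)" if "cmod w \<le> 2 * h" for w
  proof -
    have Imw: "Im (z - w) > 0" using that abs_Im_le_cmod[of w] z assms(2) by auto
    then have "0 < Im (Ln (z - w)) \<and> Im (Ln (z - w)) < pi" by (rule Im_Ln_pos_lt_imp)
    moreover have "0 < Im (Ln z) \<and> Im (Ln z) < pi" using z by (intro Im_Ln_pos_lt_imp) auto
    moreover have "exp (Ln (z - w) - Ln z) = 1 - w / z"
    proof -
      have "z - w \<noteq> 0" using Imw by (metis less_irrefl zero_complex.sel(2))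
      then show ?thesis using nz by (simp add: exp_diff exp_Ln diff_divide_distrib del: right_minus_eq eq_iff_diff_eq_0)
    qed
    ultimately show ?thesis using Ln_exp[of "Ln (z - w) - Ln z"] by simp
  qed
  have Re_pos: "0 < Re (1 - w / z)" if "cmod w \<le> 2 * h" for w
    using small[OF that] abs_Re_le_cmod[of "w / z"] by simp
  have tips: "cmod tip \<le> 2 * h" "cmod (cnj tip) \<le> 2 * h" using cmod_tip_le by auto
  \<comment> \<open>The two summands are estimated separately: the first by 8 h^2, the second by 3
    \<epsilon> h.\<close>
  define \<xi> where "\<xi> = (tip * cnj tip - (tip + cnj tip) * z) / z\<^sup>2"
  have prod: "(1 - tip / z) * (1 - cnj tip / z) = 1 + \<xi>"
    using nz by (simp add: \<xi>_def field_simps power2_eq_square)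
  have "z \<in> right_or_above" using z assms(2) by (simp add: right_or_above_def)
  then have "log_tip z + Ln (z - cnj tip) - 2 * Ln z = Ln (1 - tip / z) + Ln (1 - cnj tip / z)"
    unfolding log_tip_right[OF \<open>z \<in> right_or_above\<close>] Ln_div[OF tips(1), symmetric] Ln_div[OF tips(2), symmetric]
    by simp
  also have "\<dots> = Ln ((1 - tip / z) * (1 - cnj tip / z))"
    by (intro Ln_times_Re_pos[symmetric] Re_pos tips)
  finally have eq: "log_tip z + Ln (z - cnj tip) - 2 * Ln z = Ln (1 + \<xi>)" using prod by simp
  have gh: "\<bar>g h\<bar> \<le> \<epsilon> * h" using g_bound[of h] h_pos by simp
  have "cmod (tip * cnj tip / z\<^sup>2) = (cmod tip / cmod z)\<^sup>2"
    by (simp add: norm_divide norm_mult norm_power power2_eq_square)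
  also have "\<dots> \<le> (2 * h / (3/4))\<^sup>2"
    using tips cz h_pos by (intro power_mono frac_le) auto
  also have "\<dots> = 64 / 9 * h\<^sup>2" by (simp add: power2_eq_square)
  also have "\<dots> \<le> 8 * h\<^sup>2" by (intro mult_right_mono) auto
  finally have 1: "cmod (tip * cnj tip / z\<^sup>2) \<le> 8 * h\<^sup>2" .
  have "tip + cnj tip = of_real (2 * g h)" by (simp add: complex_eq_iff)
  then have "cmod ((tip + cnj tip) * z / z\<^sup>2) = 2 * \<bar>g h\<bar> / cmod z"
    by (simp add: norm_divide norm_mult power2_eq_square)
  also have "\<dots> \<le> 2 * (\<epsilon> * h) / (3/4)" using gh cz by (intro frac_le) auto
  also have "\<dots> = 8 / 3 * (\<epsilon> * h)" by simp
  also have "\<dots> \<le> 3 * (\<epsilon> * h)" using eps h_pos by (intro mult_right_mono) auto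
  finally have 2: "cmod ((tip + cnj tip) * z / z\<^sup>2) \<le> 3 * \<epsilon> * h" by simp
  have \<xi>: "cmod \<xi> \<le> 3 * \<epsilon> * h + 8 * h\<^sup>2"
    using norm_triangle_ineq4[of "tip * cnj tip / z\<^sup>2" "(tip + cnj tip) * z / z\<^sup>2"] 1 2
    by (simp add: \<xi>_def diff_divide_distrib)
  have "\<epsilon> * h \<le> 1 * (1/16)" using eps h_pos assms(2) by (intro mult_mono) auto
  moreover have "h\<^sup>2 \<le> (1/16)\<^sup>2" using h_pos assms(2) by (intro power_mono) auto
  ultimately have "cmod \<xi> < 1/2" using \<xi> by (simp add: power2_eq_square)
  then have "cmod (Ln (1 + \<xi>)) \<le> 2 * cmod \<xi>" by (rule norm_Ln_le)
  then have "\<bar>Im (Ln (1 + \<xi>))\<bar> \<le> 2 * cmod \<xi>" using abs_Im_le_cmod order_trans by blast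
  then have "\<bar>angle z\<bar> \<le> (1 / pi) * (2 * cmod \<xi>)"
    unfolding angle_def eq by (simp add: abs_mult divide_right_mono)
  also have "\<dots> \<le> (1 / 2) * (2 * cmod \<xi>)"
    using pi_ge_two by (intro mult_right_mono) (auto simp: field_simps)
  finally show ?thesis using \<xi> eps h_pos mult_nonneg_nonneg[of \<epsilon> h] zero_le_power2[of h] by linarith
qed

section \<open>Boundary values on the real axis and on the two sides of the slit\<close>

text \<open>The slit lies in the cone |Re z| \<le> Im z, so points with Re z > x / 2 > Im z are to
  the right of it. Limits at a nonzero real point can therefore be computed with a single formula
  for the logarithm.\<close>

lemma dom_near_positive:
  assumes "x > 0"
  shows "at (of_real x) within dom \<le> at (of_real x) within right"
proof (rule at_within_le_if_eventually)
  have "\<forall>\<^sub>F z in nhds (of_real x). z \<in> {z. Re z > x / 2 \<and> Im z < x / 2}"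
    using assms by (intro eventually_nhds_in_open open_Collect_conj open_Collect_less continuous_intros) auto
  then show "\<forall>\<^sub>F z in nhds (of_real x). z \<in> dom \<longrightarrow> z \<in> right"
  proof eventually_elim
    case (elim z)
    have "\<bar>g (Im z)\<bar> \<le> 1 * \<bar>Im z\<bar>"
      using g_bound[of "Im z"] mult_right_mono[OF eps(2), of "\<bar>Im z\<bar>"] by simp
    then show ?case using elim dom_subset by (auto simp: right_def upper_half_plane_def)
  qed
qed

lemma dom_near_negative:
  assumes "x < 0"
  shows "at (of_real x) within dom \<le> at (of_real x) within left"
proof (rule at_within_le_if_eventually)
  have "\<forall>\<^sub>F z in nhds (of_real x). z \<in> {z. Re z < x / 2 \<and> Im z < - x / 2}"
    using assms by (intro eventually_nhds_in_open open_Collect_conj open_Collect_less continuous_intros) auto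
  then show "\<forall>\<^sub>F z in nhds (of_real x). z \<in> dom \<longrightarrow> z \<in> left"
  proof eventually_elim
    case (elim z)
    have "\<bar>g (Im z)\<bar> \<le> 1 * \<bar>Im z\<bar>"
      using g_bound[of "Im z"] mult_right_mono[OF eps(2), of "\<bar>Im z\<bar>"] by simp
    then show ?case using elim dom_subset by (auto simp: left_def upper_half_plane_def)
  qed
qed

text \<open>Below the height of the tip the domain is the union of its two sides, so two one-sided
  limits control the behavior in the whole domain near a slit point.\<close>

lemma dom_near_slit:
  assumes "0 < y" "y < h"
  shows "at (Complex (g y) y) within dom
    \<le> sup (at (Complex (g y) y) within right) (at (Complex (g y) y) within left)"
  unfolding at_within_union[symmetric]
proof (rule at_within_le_if_eventually)
  have "\<forall>\<^sub>F z in nhds (Complex (g y) y). z \<in> {z. Im z < h}"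
    using assms by (intro eventually_nhds_in_open open_Collect_less continuous_intros) auto
  then show "\<forall>\<^sub>F z in nhds (Complex (g y) y). z \<in> dom \<longrightarrow> z \<in> right \<union> left"
    by eventually_elim (auto simp: dom_eq right_or_above_def left_or_above_def right_def left_def)
qed

text \<open>The maximum principle with exceptional points 0 and \<open>tip\<close>, in a form that
  treats the two sides of the slit as different boundary arcs. The other points outside the domain
  lie below the real axis, where nothing is to be shown, on the real axis, or inside the
  slit.\<close>

lemma comparison_principle:
  assumes harm: "harmonic_on v dom" and bdd: "\<And>z. z \<in> dom \<Longrightarrow> v z \<le> M"
    and right: "\<And>y. 0 < y \<Longrightarrow> y < h \<Longrightarrow> \<exists>l\<le>0. (v \<longlongrightarrow> l) (at (Complex (g y) y) within right)"
    and left: "\<And>y. 0 < y \<Longrightarrow> y < h \<Longrightarrow> \<exists>l\<le>0. (v \<longlongrightarrow> l) (at (Complex (g y) y) within left)"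
    and real: "\<And>x. x \<noteq> 0 \<Longrightarrow> (v \<longlongrightarrow> 0) (at (of_real x) within dom)"
    and "z \<in> dom"
  shows "v z \<le> 0"
proof (rule harmonic_maximum_principle_except[OF open_dom dom_subset tip_not_in_dom harm bdd _ \<open>z \<in> dom\<close>])
  fix e :: real and p :: complex
  assume e: "e > 0" and p: "p \<notin> dom" "p \<noteq> 0" "p \<noteq> tip"
  have lim: "\<forall>\<^sub>F z in F. v z < e" if "(v \<longlongrightarrow> l) F" "l \<le> 0" for l F
    using order_tendstoD(2)[OF that(1)] that(2) e by simp
  consider "Im p < 0" | "Im p = 0" | "Im p > 0" by linarith
  then show "\<forall>\<^sub>F z in at p within dom. v z < e"
  proof cases
    case 1
    then have "\<forall>\<^sub>F z in nhds p. z \<in> {z. Im z < 0}"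
      by (intro eventually_nhds_in_open open_Collect_less continuous_intros) auto
    then have "\<forall>\<^sub>F z in nhds p. z \<noteq> p \<longrightarrow> z \<in> dom \<longrightarrow> v z < e"
      by eventually_elim (use dom_subset in \<open>auto simp: upper_half_plane_def\<close>)
    then show ?thesis by (simp add: eventually_at_filter)
  next
    case 2
    then have "p = of_real (Re p)" "Re p \<noteq> 0" using p by (auto simp: complex_eq_iff)
    then show ?thesis using lim[OF real[of "Re p"]] by simp
  next
    case 3
    then have "p \<in> slit" using p by (auto simp: dom_def upper_half_plane_def)
    then have peq: "p = Complex (g (Im p)) (Im p)" and "Im p \<le> h" by (auto simp: slit_def complex_eq_iff)
    moreover have "Im p \<noteq> h" using p(3) peq by (metis tip_def)
    ultimately have y: "Im p < h" by simp
    have "\<forall>\<^sub>F z in at p within right. v z < e" "\<forall>\<^sub>F z in at p within left. v z < e"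
      using right[OF 3 y] left[OF 3 y] lim peq by metis+
    then have "\<forall>\<^sub>F z in sup (at p within right) (at p within left). v z < e"
      by (simp add: eventually_sup)
    then show ?thesis using dom_near_slit[OF 3 y] peq unfolding le_filter_def by metis
  qed
qed

lemma tendsto_log_tip_right:
  assumes "p - tip \<notin> \<real>\<^sub>\<le>\<^sub>0"
  shows "(log_tip \<longlongrightarrow> Ln (p - tip)) (at p within right)"
proof (rule Lim_transform_eventually)
  show "((\<lambda>z. Ln (z - tip)) \<longlongrightarrow> Ln (p - tip)) (at p within right)"
    by (intro tendsto_intros assms)
  show "\<forall>\<^sub>F z in at p within right. Ln (z - tip) = log_tip z"
    using right_subset log_tip_right by (auto simp: eventually_at_filter intro!: always_eventually)
qed

lemma tendsto_log_tip_left: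
  assumes "tip - p \<notin> \<real>\<^sub>\<le>\<^sub>0"
  shows "(log_tip \<longlongrightarrow> Ln (tip - p) + \<i> * pi) (at p within left)"
proof (rule Lim_transform_eventually)
  show "((\<lambda>z. Ln (tip - z) + \<i> * pi) \<longlongrightarrow> Ln (tip - p) + \<i> * pi) (at p within left)"
    by (intro tendsto_intros assms)
  show "\<forall>\<^sub>F z in at p within left. Ln (tip - z) + \<i> * pi = log_tip z"
    using left_subset log_tip_left by (auto simp: eventually_at_filter intro!: always_eventually)
qed

text \<open>The limits of \<open>log_tip\<close> and of \<open>Ln\<close> depend on the side of
  approach and are supplied by the caller. The remaining logarithm is continuous on the closed
  half-plane, because \<open>cnj tip\<close> lies below the real axis.\<close>

lemma tendsto_angle:
  assumes "(log_tip \<longlongrightarrow> l) F" "(Ln \<longlongrightarrow> m) F" "F \<le> nhds p" "Im p \<ge> 0"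
  shows "(angle \<longlongrightarrow> - (1 / pi) * Im (l + Ln (p - cnj tip) - 2 * m)) F"
proof -
  have "p - cnj tip \<notin> \<real>\<^sub>\<le>\<^sub>0" using assms h_pos by (simp add: complex_nonpos_Reals_iff)
  moreover have "((\<lambda>z. z) \<longlongrightarrow> p) F" using assms by (simp add: filterlim_def)
  ultimately show ?thesis unfolding angle_def by (intro tendsto_intros assms)
qed

lemma tendsto_height:
  assumes "(log_tip \<longlongrightarrow> l) F" "F \<le> nhds p" "Im p \<ge> 0"
  shows "(height \<longlongrightarrow> Im (p - exp ((l + Ln (p - cnj tip)) / 2))) F"
proof -
  have "p - cnj tip \<notin> \<real>\<^sub>\<le>\<^sub>0" using assms h_pos by (simp add: complex_nonpos_Reals_iff)
  moreover have "((\<lambda>z. z) \<longlongrightarrow> p) F" using assms by (simp add: filterlim_def)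
  ultimately show ?thesis unfolding height_def by (intro tendsto_intros assms) simp_all
qed

lemma at_within_le_nhds: "at p within A \<le> nhds p"
  by (simp add: at_within_def)

text \<open>The Lipschitz bound limits the slope of the chords from a slit point to the tip and to
  0. For the segment to \<open>cnj tip\<close> the horizontal distance is that to the tip while the
  vertical one is larger.\<close>

lemma slit_point_angles:
  assumes y: "0 < y" "y < h"
  defines "p \<equiv> Complex (g y) y"
  shows "\<bar>Im (Ln (p - tip)) + pi / 2\<bar> \<le> \<epsilon>" "\<bar>Im (Ln (tip - p)) - pi / 2\<bar> \<le> \<epsilon>"
    "\<bar>Im (Ln (p - cnj tip)) - pi / 2\<bar> \<le> \<epsilon>" "\<bar>Im (Ln p) - pi / 2\<bar> \<le> \<epsilon>"
proof -
  have 1: "\<bar>g y - g h\<bar> \<le> \<epsilon> * (h - y)" using lipschitz[of y h] y by simp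
  show "\<bar>Im (Ln (p - tip)) + pi / 2\<bar> \<le> \<epsilon>"
    using 1 y by (intro Im_Ln_near_minus_pi_half) (auto simp: p_def)
  show "\<bar>Im (Ln (tip - p)) - pi / 2\<bar> \<le> \<epsilon>"
    using 1 y by (intro Im_Ln_near_pi_half) (auto simp: p_def abs_minus_commute)
  have "\<epsilon> * (h - y) \<le> \<epsilon> * (y + h)" using y eps by (intro mult_left_mono) auto
  then show "\<bar>Im (Ln (p - cnj tip)) - pi / 2\<bar> \<le> \<epsilon>"
    using 1 y by (intro Im_Ln_near_pi_half) (auto simp: p_def)
  show "\<bar>Im (Ln p) - pi / 2\<bar> \<le> \<epsilon>"
    using g_bound[of y] y by (intro Im_Ln_near_pi_half) (auto simp: p_def)
qed

text \<open>For a vertical slit the arguments add up to - pi/2 + pi/2 - 2 pi/2 = - pi. The four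
  errors of size \<epsilon> are divided by pi, which is at least 2.\<close>

lemma angle_right_side:
  assumes y: "0 < y" "y < h"
  shows "\<exists>a. (angle \<longlongrightarrow> a) (at (Complex (g y) y) within right) \<and> \<bar>a - 1\<bar> \<le> 2 * \<epsilon>"
proof -
  define p where "p = Complex (g y) y"
  have "p - tip \<notin> \<real>\<^sub>\<le>\<^sub>0" "p \<notin> \<real>\<^sub>\<le>\<^sub>0" using y by (auto simp: p_def complex_nonpos_Reals_iff)
  then have "(angle \<longlongrightarrow> - (1 / pi) * Im (Ln (p - tip) + Ln (p - cnj tip) - 2 * Ln p)) (at p within right)"
    using y by (intro tendsto_angle tendsto_log_tip_right at_within_le_nhds tendsto_intros) (auto simp: p_def)
  moreover have "\<bar>Im (Ln (p - tip) + Ln (p - cnj tip) - 2 * Ln p) + pi\<bar> \<le> 4 * \<epsilon>"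
    using slit_point_angles[OF y, folded p_def] by (simp add: abs_le_iff)
  then have "\<bar>- (1 / pi) * Im (Ln (p - tip) + Ln (p - cnj tip) - 2 * Ln p) - 1\<bar> \<le> 2 * \<epsilon>" (is "\<bar>- (1 / pi) * ?a - 1\<bar> \<le> _")
  proof -
    assume a: "\<bar>?a + pi\<bar> \<le> 4 * \<epsilon>"
    have "\<bar>- (1 / pi) * ?a - 1\<bar> = \<bar>- (1 / pi) * (?a + pi)\<bar>" by (simp add: field_simps)
    also have "\<dots> = \<bar>?a + pi\<bar> / pi" by (simp only: abs_mult) simp
    also have "\<dots> \<le> 4 * \<epsilon> / 2" using a pi_ge_two eps by (intro frac_le) auto
    finally show ?thesis by simp
  qed
  ultimately show ?thesis unfolding p_def by blast
qed

text \<open>On this side the argument of \<open>log_tip\<close> is larger by 2 pi, and the sum is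
  (pi/2 + pi) + pi/2 - 2 pi/2 = pi up to 4 \<epsilon>.\<close>

lemma angle_left_side:
  assumes y: "0 < y" "y < h"
  shows "\<exists>a. (angle \<longlongrightarrow> a) (at (Complex (g y) y) within left) \<and> \<bar>a + 1\<bar> \<le> 2 * \<epsilon>"
proof -
  define p where "p = Complex (g y) y"
  have "tip - p \<notin> \<real>\<^sub>\<le>\<^sub>0" "p \<notin> \<real>\<^sub>\<le>\<^sub>0" using y by (auto simp: p_def complex_nonpos_Reals_iff)
  then have "(angle \<longlongrightarrow> - (1 / pi) * Im (Ln (tip - p) + \<i> * pi + Ln (p - cnj tip) - 2 * Ln p)) (at p within left)"
    using y by (intro tendsto_angle tendsto_log_tip_left at_within_le_nhds tendsto_intros) (auto simp: p_def)
  moreover have "\<bar>Im (Ln (tip - p) + \<i> * pi + Ln (p - cnj tip) - 2 * Ln p) - pi\<bar> \<le> 4 * \<epsilon>"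
    using slit_point_angles[OF y, folded p_def] by (simp add: abs_le_iff)
  then have "\<bar>- (1 / pi) * Im (Ln (tip - p) + \<i> * pi + Ln (p - cnj tip) - 2 * Ln p) + 1\<bar> \<le> 2 * \<epsilon>" (is "\<bar>- (1 / pi) * ?a + 1\<bar> \<le> _")
  proof -
    assume a: "\<bar>?a - pi\<bar> \<le> 4 * \<epsilon>"
    have "\<bar>- (1 / pi) * ?a + 1\<bar> = \<bar>- (1 / pi) * (?a - pi)\<bar>" by (simp add: field_simps)
    also have "\<dots> = \<bar>?a - pi\<bar> / pi" by (simp only: abs_mult) simp
    also have "\<dots> \<le> 4 * \<epsilon> / 2" using a pi_ge_two eps by (intro frac_le) auto
    finally show ?thesis by simp
  qed
  ultimately show ?thesis unfolding p_def by blast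
qed

lemma height_limit_le:
  assumes "(height \<longlongrightarrow> a) (at p within A)" "A \<subseteq> dom"
  shows "\<exists>a\<le>2 * h. (height \<longlongrightarrow> a) (at p within A)"
proof (cases "at p within A = bot")
  case True
  \<comment> \<open>Along the trivial filter every number is a limit, and 0 satisfies the
    bound.\<close>
  then show ?thesis using h_pos by (intro exI[of _ 0]) auto
next
  case False
  have "\<forall>\<^sub>F z in at p within A. height z \<le> 2 * h"
    using assms(2) height_le by (auto simp: eventually_at_filter intro!: always_eventually)
  then show ?thesis using tendsto_upperbound[OF assms(1) _ False] assms(1) by blast
qed

lemma height_sides:
  assumes "0 < y" "y < h"
  shows "\<exists>a\<le>2 * h. (height \<longlongrightarrow> a) (at (Complex (g y) y) within right)"
    and "\<exists>a\<le>2 * h. (height \<longlongrightarrow> a) (at (Complex (g y) y) within left)"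
proof -
  define p where "p = Complex (g y) y"
  have p: "p - tip \<notin> \<real>\<^sub>\<le>\<^sub>0" "tip - p \<notin> \<real>\<^sub>\<le>\<^sub>0" "Im p \<ge> 0"
    using assms by (auto simp: p_def complex_nonpos_Reals_iff)
  have "right \<subseteq> dom" "left \<subseteq> dom" using dom_eq right_subset left_subset by auto
  then show "\<exists>a\<le>2 * h. (height \<longlongrightarrow> a) (at (Complex (g y) y) within right)"
    "\<exists>a\<le>2 * h. (height \<longlongrightarrow> a) (at (Complex (g y) y) within left)"
    using tendsto_height[OF tendsto_log_tip_right[OF p(1)] at_within_le_nhds p(3)]
      tendsto_height[OF tendsto_log_tip_left[OF p(2)] at_within_le_nhds p(3)] height_limit_le
    unfolding p_def by blast+
qed

text \<open>Seen from a real point, \<open>tip\<close> and \<open>cnj tip\<close> are mirror images,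
  so the arguments of the two factors add up to 0 to the right of the slit and to 2 pi to the left
  of it. This cancels twice the argument of \<open>x\<close>, and the exponential of half the sum of
  logarithms is real.\<close>

lemma tendsto_at_real:
  assumes "x \<noteq> 0"
  shows "(angle \<longlongrightarrow> 0) (at (of_real x) within dom)" "(height \<longlongrightarrow> 0) (at (of_real x) within dom)"
proof -
  define p where "p = complex_of_real x"
  have nonreal: "p - tip \<notin> \<real>\<^sub>\<le>\<^sub>0" "tip - p \<notin> \<real>\<^sub>\<le>\<^sub>0" "p - cnj tip \<notin> \<real>\<^sub>\<le>\<^sub>0"
    using h_pos by (auto simp: p_def complex_nonpos_Reals_iff)
  have "(angle \<longlongrightarrow> 0) (at p within dom) \<and> (height \<longlongrightarrow> 0) (at p within dom)"
  proof (cases "x > 0")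
    case True
    have "p \<notin> \<real>\<^sub>\<le>\<^sub>0" using True by (simp add: p_def complex_nonpos_Reals_iff)
    then have Ln: "(Ln \<longlongrightarrow> Ln p) (at p within right)" by (intro tendsto_intros)
    have "Ln (p - cnj tip) = cnj (Ln (p - tip))"
      using cnj_Ln[OF nonreal(1)] by (simp add: p_def)
    then have sum: "Im (Ln (p - tip) + Ln (p - cnj tip)) = 0" by simp
    have "Im (Ln p) = 0" using True by (simp add: p_def Ln_of_real)
    then have "- (1 / pi) * Im (Ln (p - tip) + Ln (p - cnj tip) - 2 * Ln p) = 0" using sum by simp
    then have "(angle \<longlongrightarrow> 0) (at p within right)"
      using tendsto_angle[OF tendsto_log_tip_right[OF nonreal(1)] Ln at_within_le_nhds] by (simp add: p_def)
    moreover have "Im (p - exp ((Ln (p - tip) + Ln (p - cnj tip)) / 2)) = 0"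
      using sum by (simp add: Im_exp p_def)
    then have "(height \<longlongrightarrow> 0) (at p within right)"
      using tendsto_height[OF tendsto_log_tip_right[OF nonreal(1)] at_within_le_nhds] by (simp add: p_def)
    ultimately show ?thesis
      using dom_near_positive[OF True] by (auto simp: p_def intro: tendsto_mono)
  next
    case False
    then have x: "x < 0" using assms by simp
    have "at p within left \<le> at p within upper_half_plane"
      by (intro at_le) (auto simp: left_def upper_half_plane_def)
    then have Ln: "(Ln \<longlongrightarrow> Ln (- p) + \<i> * pi) (at p within left)"
      using tendsto_Ln_negative_real[OF x] by (auto simp: p_def intro: tendsto_mono)
    \<comment> \<open>\<open>w\<close> lies in the lower half-plane and is conjugate to tip - p, so
      passing from \<open>w\<close> to - w contributes the second pi of the sum.\<close>
    define w where "w = cnj tip - p"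
    have "Im w < 0" using h_pos by (simp add: w_def p_def)
    then have "Ln (- w) = Ln w + \<i> * pi" by (subst Ln_minus) auto
    moreover have "Ln w = cnj (Ln (tip - p))"
      using cnj_Ln[OF nonreal(2)] by (simp add: w_def p_def)
    ultimately have sum: "Im (Ln (tip - p) + \<i> * pi + Ln (p - cnj tip)) = 2 * pi" by (simp add: w_def)
    have "Im (Ln (- p)) = 0" using x Ln_of_real[of "- x"] by (simp add: p_def)
    then have "- (1 / pi) * Im (Ln (tip - p) + \<i> * pi + Ln (p - cnj tip) - 2 * (Ln (- p) + \<i> * pi)) = 0"
      using sum by simp
    then have "(angle \<longlongrightarrow> 0) (at p within left)"
      using tendsto_angle[OF tendsto_log_tip_left[OF nonreal(2)] Ln at_within_le_nhds] by (simp add: p_def)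
    moreover define E where "E = (Ln (tip - p) + \<i> * pi + Ln (p - cnj tip)) / 2"
    have "Im E = pi" using sum by (simp add: E_def)
    then have "Im (p - exp E) = 0" by (simp add: Im_exp p_def)
    then have "(height \<longlongrightarrow> 0) (at p within left)"
      using tendsto_height[OF tendsto_log_tip_left[OF nonreal(2)] at_within_le_nhds, folded E_def]
      by (simp add: p_def)
    ultimately show ?thesis
      using dom_near_negative[OF x] by (auto simp: p_def intro: tendsto_mono)
  qed
  then show "(angle \<longlongrightarrow> 0) (at (of_real x) within dom)" "(height \<longlongrightarrow> 0) (at (of_real x) within dom)"
    by (auto simp: p_def)
qed

section \<open>Comparison of the harmonic measures of the two sides near \<i>\<close>

text \<open>The sum \<open>s\<close> of the two measures tends to 1 on both sides of the slit and to
  0 on the real axis, so every error on the slit can be absorbed by a multiple of \<open>s\<close>;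
  a lower bound for \<open>s\<close> turns the remaining absolute error into a relative one.\<close>

lemma harmonic_measures_near_i:
  assumes harm1: "harmonic_on \<omega>1 dom" and bdd1: "bounded (\<omega>1 ` dom)"
    and harm2: "harmonic_on \<omega>2 dom" and bdd2: "bounded (\<omega>2 ` dom)"
    and right1: "\<And>y. 0 < y \<Longrightarrow> y < h \<Longrightarrow> (\<omega>1 \<longlongrightarrow> 1) (at (Complex (g y) y) within right)"
    and left1: "\<And>y. 0 < y \<Longrightarrow> y < h \<Longrightarrow> (\<omega>1 \<longlongrightarrow> 0) (at (Complex (g y) y) within left)"
    and right2: "\<And>y. 0 < y \<Longrightarrow> y < h \<Longrightarrow> (\<omega>2 \<longlongrightarrow> 0) (at (Complex (g y) y) within right)"
    and left2: "\<And>y. 0 < y \<Longrightarrow> y < h \<Longrightarrow> (\<omega>2 \<longlongrightarrow> 1) (at (Complex (g y) y) within left)"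
    and real1: "\<And>x. x \<noteq> 0 \<Longrightarrow> (\<omega>1 \<longlongrightarrow> 0) (at (of_real x) within dom)"
    and real2: "\<And>x. x \<noteq> 0 \<Longrightarrow> (\<omega>2 \<longlongrightarrow> 0) (at (of_real x) within dom)"
    and z: "cmod (z - \<i>) \<le> 1/4" and h: "h \<le> 1/16"
  shows "0 < \<omega>1 z + \<omega>2 z" "\<bar>\<omega>1 z - \<omega>2 z\<bar> \<le> (290 * \<epsilon> + 1152 * h) * (\<omega>1 z + \<omega>2 z)"
proof -
  define s where "s z = \<omega>1 z + \<omega>2 z" for z
  obtain M1 M2 where M: "\<And>z. z \<in> dom \<Longrightarrow> \<bar>\<omega>1 z\<bar> \<le> M1" "\<And>z. z \<in> dom \<Longrightarrow> \<bar>\<omega>2 z\<bar> \<le> M2"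
    using bdd1 bdd2 unfolding bounded_iff by auto
  have sM: "\<bar>s z\<bar> \<le> M1 + M2" "\<bar>\<omega>1 z - \<omega>2 z\<bar> \<le> M1 + M2" if "z \<in> dom" for z
    using M[OF that] unfolding s_def by linarith+
  have zd: "z \<in> dom" using height_near_i(1)[OF z] h by simp
  have s_right: "(s \<longlongrightarrow> 1 + 0) (at (Complex (g y) y) within right)"
    and s_left: "(s \<longlongrightarrow> 0 + 1) (at (Complex (g y) y) within left)" if "0 < y" "y < h" for y
    unfolding s_def using that by (intro tendsto_add right1 right2 left1 left2; simp)+
  have s_real: "(s \<longlongrightarrow> 0 + 0) (at (of_real x) within dom)" if "x \<noteq> 0" for x
    unfolding s_def using that by (intro tendsto_add real1 real2)
  have harm_s: "harmonic_on s dom" unfolding s_def by (intro harmonic_on_add harm1 harm2)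

  \<comment> \<open>On the slit \<open>height\<close> is at most 2 h while \<open>s\<close> tends to
    1; the lower bound of \<open>height\<close> near \<i> then passes to \<open>s\<close>.\<close>
  have "height z - 2 * h * s z \<le> 0"
  proof (rule comparison_principle[OF _ _ _ _ _ zd])
    show "harmonic_on (\<lambda>z. height z - 2 * h * s z) dom"
      by (intro harmonic_on_diff harmonic_on_cmult harm_s harmonic_height)
    show "height z - 2 * h * s z \<le> 2 * h + 2 * h * (M1 + M2)" if "z \<in> dom" for z
    proof -
      have "2 * h * - s z \<le> 2 * h * (M1 + M2)" using sM[OF that] h_pos by (intro mult_left_mono) auto
      then show ?thesis using height_le[OF that] by simp
    qed
    show "\<exists>l\<le>0. ((\<lambda>z. height z - 2 * h * s z) \<longlongrightarrow> l) (at (Complex (g y) y) within right)"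
      if y: "0 < y" "y < h" for y
    proof -
      obtain a where "a \<le> 2 * h" "(height \<longlongrightarrow> a) (at (Complex (g y) y) within right)"
        using height_sides(1)[OF y] by blast
      then show ?thesis using s_right[OF y]
        by (intro exI[of _ "a - 2 * h * (1 + 0)"] conjI tendsto_diff tendsto_mult tendsto_const) auto
    qed
    show "\<exists>l\<le>0. ((\<lambda>z. height z - 2 * h * s z) \<longlongrightarrow> l) (at (Complex (g y) y) within left)"
      if y: "0 < y" "y < h" for y
    proof -
      obtain a where "a \<le> 2 * h" "(height \<longlongrightarrow> a) (at (Complex (g y) y) within left)"
        using height_sides(2)[OF y] by blast
      then show ?thesis using s_left[OF y]
        by (intro exI[of _ "a - 2 * h * (0 + 1)"] conjI tendsto_diff tendsto_mult tendsto_const) auto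
    qed
    show "((\<lambda>z. height z - 2 * h * s z) \<longlongrightarrow> 0) (at (of_real x) within dom)" if "x \<noteq> 0" for x
      using tendsto_diff[OF tendsto_at_real(2)[OF that] tendsto_mult[OF tendsto_const s_real[OF that]], of "2 * h"]
      by simp
  qed
  then have "h\<^sup>2 / 36 \<le> 2 * h * s z" using height_near_i(2)[OF z] h by simp
  then have "h * (h / 72) \<le> h * s z" by (simp add: power2_eq_square)
  then have lower: "h / 72 \<le> s z" using h_pos by simp
  then show "0 < \<omega>1 z + \<omega>2 z" using h_pos unfolding s_def by linarith

  \<comment> \<open>The two signs of \<open>k\<close> give the two halves of an absolute value. On
    the sides, \<open>angle\<close> misses the values 1 and -1 of \<omega>1 - \<omega>2 by at most 2
    \<epsilon>.\<close>
  have upper: "k * (\<omega>1 z - \<omega>2 z - angle z) - 2 * \<epsilon> * s z \<le> 0" if k: "k = 1 \<or> k = -1" for k :: real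
  proof (rule comparison_principle[OF _ _ _ _ _ zd])
    show "harmonic_on (\<lambda>z. k * (\<omega>1 z - \<omega>2 z - angle z) - 2 * \<epsilon> * s z) dom"
      by (intro harmonic_on_diff harmonic_on_cmult harm_s harm1 harm2 harmonic_angle)
    show "k * (\<omega>1 z - \<omega>2 z - angle z) - 2 * \<epsilon> * s z \<le> M1 + M2 + 5 + 2 * \<epsilon> * (M1 + M2)" if "z \<in> dom" for z
    proof -
      have "2 * \<epsilon> * - s z \<le> 2 * \<epsilon> * (M1 + M2)" using sM[OF that] eps by (intro mult_left_mono) auto
      moreover have "k * (\<omega>1 z - \<omega>2 z - angle z) \<le> M1 + M2 + 5"
        using k sM(2)[OF that] angle_bounded[OF that] by auto
      ultimately show ?thesis by simp
    qed
    show "\<exists>l\<le>0. ((\<lambda>z. k * (\<omega>1 z - \<omega>2 z - angle z) - 2 * \<epsilon> * s z) \<longlongrightarrow> l) (at (Complex (g y) y) within right)"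
      if y: "0 < y" "y < h" for y
    proof -
      obtain a where "\<bar>a - 1\<bar> \<le> 2 * \<epsilon>" and a: "(angle \<longlongrightarrow> a) (at (Complex (g y) y) within right)"
        using angle_right_side[OF y] by blast
      then have "k * (1 - 0 - a) - 2 * \<epsilon> * (1 + 0) \<le> 0" using k by auto
      moreover have "((\<lambda>z. k * (\<omega>1 z - \<omega>2 z - angle z) - 2 * \<epsilon> * s z) \<longlongrightarrow> k * (1 - 0 - a) - 2 * \<epsilon> * (1 + 0))
          (at (Complex (g y) y) within right)"
        by (intro tendsto_diff tendsto_mult tendsto_const s_right y right1 right2 a)
      ultimately show ?thesis by blast
    qed
    show "\<exists>l\<le>0. ((\<lambda>z. k * (\<omega>1 z - \<omega>2 z - angle z) - 2 * \<epsilon> * s z) \<longlongrightarrow> l) (at (Complex (g y) y) within left)"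
      if y: "0 < y" "y < h" for y
    proof -
      obtain a where "\<bar>a + 1\<bar> \<le> 2 * \<epsilon>" and a: "(angle \<longlongrightarrow> a) (at (Complex (g y) y) within left)"
        using angle_left_side[OF y] by blast
      then have "k * (0 - 1 - a) - 2 * \<epsilon> * (0 + 1) \<le> 0" using k by auto
      moreover have "((\<lambda>z. k * (\<omega>1 z - \<omega>2 z - angle z) - 2 * \<epsilon> * s z) \<longlongrightarrow> k * (0 - 1 - a) - 2 * \<epsilon> * (0 + 1))
          (at (Complex (g y) y) within left)"
        by (intro tendsto_diff tendsto_mult tendsto_const s_left y left1 left2 a)
      ultimately show ?thesis by blast
    qed
    show "((\<lambda>z. k * (\<omega>1 z - \<omega>2 z - angle z) - 2 * \<epsilon> * s z) \<longlongrightarrow> 0) (at (of_real x) within dom)" if "x \<noteq> 0" for x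
    proof -
      have "((\<lambda>z. k * (\<omega>1 z - \<omega>2 z - angle z) - 2 * \<epsilon> * s z) \<longlongrightarrow> k * (0 - 0 - 0) - 2 * \<epsilon> * (0 + 0))
          (at (of_real x) within dom)"
        by (intro tendsto_diff tendsto_mult tendsto_const s_real that real1 real2 tendsto_at_real(1))
      then show ?thesis by simp
    qed
  qed
  have "\<bar>\<omega>1 z - \<omega>2 z\<bar> \<le> 2 * \<epsilon> * s z + \<bar>angle z\<bar>" using upper[of 1] upper[of "-1"] by auto
  \<comment> \<open>The factor h / 72 is split off because it is the lower bound for
    \<open>s\<close>: 288 = 4 * 72 and 1152 = 16 * 72.\<close>
  also have "\<bar>angle z\<bar> \<le> (288 * \<epsilon> + 1152 * h) * (h / 72)"
    using angle_near_i[OF z h] by (simp add: power2_eq_square algebra_simps)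
  also have "\<dots> \<le> (288 * \<epsilon> + 1152 * h) * s z"
    using lower eps h_pos by (intro mult_left_mono) auto
  finally show "\<bar>\<omega>1 z - \<omega>2 z\<bar> \<le> (290 * \<epsilon> + 1152 * h) * (\<omega>1 z + \<omega>2 z)"
    by (simp add: s_def algebra_simps)
qed

end

section \<open>Smooth curves and the Loewner equation\<close>

text \<open>Next to the slit, on the side \<sigma>, there is a connected curvilinear rectangle
  \<open>Q\<close> inside any given ball about the point. It contains the small displacements along
  \<open>n\<close> and all points of that side close to \<open>p\<close>, so these lie in one
  component. Limits along the prime end thus become plain one-sided limits.\<close>

lemma (in graph_slit) at_side_local:
  assumes y: "0 < y" "y < h" and \<sigma>: "\<sigma> = 1 \<or> \<sigma> = -1" and n: "\<epsilon> * \<bar>Im n\<bar> < \<sigma> * Re n"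
  shows "at (Complex (g y) y) within {z. 0 < Im z \<and> 0 < \<sigma> * (Re z - g (Im z))}
    \<le> at_side dom (Complex (g y) y) n"
proof -
  define p where "p = Complex (g y) y"
  have "\<forall>\<^sub>F z in at p within {z. 0 < Im z \<and> 0 < \<sigma> * (Re z - g (Im z))}.
      \<forall>\<^sub>F e in at_right 0. connected_component (dom \<inter> ball p r) (p + of_real e * n) z"
    if r: "r > 0" for r
  proof -
    \<comment> \<open>Points of \<open>Q\<close> are within 3 \<rho> < r of \<open>p\<close>, and
      their height exceeds y - \<rho> > 0.\<close>
    define \<rho> where "\<rho> = min (r / 4) (y / 2)"
    have \<rho>: "0 < \<rho>" "4 * \<rho> \<le> r" "2 * \<rho> \<le> y" using r y by (auto simp: \<rho>_def)
    \<comment> \<open>A shear along the graph: \<open>x\<close> is the horizontal distance from the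
      slit on the side \<sigma>, so \<open>Q\<close> is the continuous image of a rectangle.\<close>
    define F where "F = (\<lambda>(x, t). Complex (g t + \<sigma> * x) t)"
    define Q where "Q = F ` ({0<..<\<rho>} \<times> {y - \<rho><..<y + \<rho>})"
    have "continuous_on ({0<..<\<rho>} \<times> {y - \<rho><..<y + \<rho>}) F"
      unfolding F_def Complex_eq case_prod_beta
      by (intro continuous_intros continuous_on_compose2[OF continuous_g[of UNIV]]) auto
    then have "connected Q" unfolding Q_def
      by (intro connected_continuous_image connected_Times) auto
    have Q_sub: "Q \<subseteq> dom \<inter> ball p r"
    proof
      fix z assume "z \<in> Q"
      then obtain x t where "(x, t) \<in> {0<..<\<rho>} \<times> {y - \<rho><..<y + \<rho>}" "z = F (x, t)"
        unfolding Q_def by blast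
      then have xt: "z = Complex (g t + \<sigma> * x) t" "0 < x" "x < \<rho>" "\<bar>t - y\<bar> < \<rho>"
        by (auto simp: F_def abs_less_iff)
      have "\<epsilon> * \<bar>t - y\<bar> \<le> 1 * \<rho>" using eps xt by (intro mult_mono) auto
      then have "\<bar>g t - g y\<bar> \<le> \<rho>" using lipschitz[of t y] by linarith
      then have "\<bar>g t + \<sigma> * x - g y\<bar> < 2 * \<rho>" using \<sigma> xt by auto
      moreover have "cmod (z - p) \<le> \<bar>g t + \<sigma> * x - g y\<bar> + \<bar>t - y\<bar>"
        using cmod_le[of "z - p"] by (simp add: xt p_def)
      ultimately have "z \<in> ball p r" using xt \<rho> by (simp add: dist_norm norm_minus_commute)
      moreover have "z \<in> dom"
        using xt \<rho> \<sigma> by (auto simp: dom_def slit_def upper_half_plane_def abs_less_iff)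
      ultimately show "z \<in> dom \<inter> ball p r" by blast
    qed
    have QI: "z \<in> Q" if "\<bar>Im z - y\<bar> < \<rho>" "0 < \<sigma> * (Re z - g (Im z))" "\<sigma> * (Re z - g (Im z)) < \<rho>" for z
      unfolding Q_def
    proof (rule image_eqI)
      show "z = F (\<sigma> * (Re z - g (Im z)), Im z)" using \<sigma> by (auto simp: F_def complex_eq_iff)
      show "(\<sigma> * (Re z - g (Im z)), Im z) \<in> {0<..<\<rho>} \<times> {y - \<rho><..<y + \<rho>}"
        using that by (auto simp: abs_less_iff)
    qed
    \<comment> \<open>For e < \<rho> / N the displacement e n is shorter than \<rho>. Over its
      height the graph drifts sideways by at most e \<epsilon> |Im n|, less than the distance e
      \<sigma> Re n covered by the point, which therefore stays on the side \<sigma>.\<close>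
    define N where "N = \<bar>Re n\<bar> + \<bar>Im n\<bar> + 1"
    have evn: "\<forall>\<^sub>F e in at_right 0. p + of_real e * n \<in> Q"
      unfolding eventually_at_right_field
    proof (intro exI[of _ "\<rho> / N"] conjI allI impI)
      show "0 < \<rho> / N" using \<rho> by (simp add: N_def)
      fix e :: real assume e: "0 < e" "e < \<rho> / N"
      then have eN: "e * N < \<rho>" by (simp add: N_def field_simps)
      have e1: "e * \<bar>Re n\<bar> + e * \<bar>Im n\<bar> < \<rho>" using eN e(1) by (simp add: N_def distrib_left)
      have nn: "0 \<le> e * \<bar>Re n\<bar>" "0 \<le> e * \<bar>Im n\<bar>" using e by auto
      have gl: "\<bar>g (y + e * Im n) - g y\<bar> \<le> \<epsilon> * \<bar>e * Im n\<bar>"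
        using lipschitz[of "y + e * Im n" y] by simp
      also have "\<dots> \<le> 1 * \<bar>e * Im n\<bar>" using eps by (intro mult_right_mono) auto
      finally have g1: "\<bar>g (y + e * Im n) - g y\<bar> \<le> e * \<bar>Im n\<bar>" using e by (simp add: abs_mult)
      have g2: "\<bar>g (y + e * Im n) - g y\<bar> \<le> e * (\<epsilon> * \<bar>Im n\<bar>)"
        using gl e by (simp add: abs_mult mult.left_commute)
      have g3: "e * (\<epsilon> * \<bar>Im n\<bar>) < e * (\<sigma> * Re n)" using n e by simp
      have sr: "\<sigma> * (Re (p + of_real e * n) - g (Im (p + of_real e * n)))
          = e * (\<sigma> * Re n) - \<sigma> * (g (y + e * Im n) - g y)"
        by (simp add: p_def algebra_simps)
      have sg: "\<bar>\<sigma> * (g (y + e * Im n) - g y)\<bar> = \<bar>g (y + e * Im n) - g y\<bar>"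
        "e * (\<sigma> * Re n) \<le> e * \<bar>Re n\<bar>" using \<sigma> e by (auto simp: abs_mult)
      show "p + of_real e * n \<in> Q"
      proof (rule QI)
        show "\<bar>Im (p + of_real e * n) - y\<bar> < \<rho>"
        proof -
          have "\<bar>Im (p + of_real e * n) - y\<bar> = e * \<bar>Im n\<bar>" using e by (simp add: p_def abs_mult)
          then show ?thesis using e1 nn by linarith
        qed
        show "0 < \<sigma> * (Re (p + of_real e * n) - g (Im (p + of_real e * n)))"
          unfolding sr using g2 g3 sg by linarith
        show "\<sigma> * (Re (p + of_real e * n) - g (Im (p + of_real e * n))) < \<rho>"
          unfolding sr using g1 e1 sg by linarith
      qed
    qed
    have "\<forall>\<^sub>F z in nhds p. z \<in> {z. \<bar>Im z - y\<bar> < \<rho> \<and> \<bar>Re z - g (Im z)\<bar> < \<rho>}"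
      using \<rho> by (intro eventually_nhds_in_open open_Collect_conj open_Collect_less continuous_g_Im continuous_intros)
        (auto simp: p_def)
    then have "\<forall>\<^sub>F z in nhds p. 0 < \<sigma> * (Re z - g (Im z)) \<longrightarrow> z \<in> Q"
      by eventually_elim (use \<sigma> in \<open>auto intro!: QI\<close>)
    then have "\<forall>\<^sub>F z in at p within {z. 0 < Im z \<and> 0 < \<sigma> * (Re z - g (Im z))}. z \<in> Q"
      unfolding eventually_at_filter by eventually_elim auto
    then show ?thesis
    proof eventually_elim
      case (elim z)
      from evn show ?case
        by eventually_elim (use \<open>connected Q\<close> Q_sub elim in \<open>auto simp: connected_component_def\<close>)
    qed
  qed
  then show ?thesis
    unfolding at_side_def le_INF_iff le_principal p_def[symmetric] by auto
qed

lemma (in graph_slit) at_right_side_le: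
  "0 < y \<Longrightarrow> y < h \<Longrightarrow> \<epsilon> * \<bar>Im n\<bar> < Re n \<Longrightarrow> at (Complex (g y) y) within right \<le> at_side dom (Complex (g y) y) n"
  using at_side_local[of y 1 n] by (simp add: right_def)

lemma (in graph_slit) at_left_side_le:
  "0 < y \<Longrightarrow> y < h \<Longrightarrow> \<epsilon> * \<bar>Im n\<bar> < - Re n \<Longrightarrow> at (Complex (g y) y) within left \<le> at_side dom (Complex (g y) y) n"
  using at_side_local[of y "-1" n] by (simp add: left_def)

section \<open>From a smooth curve perpendicular to the real axis to a Lipschitz graph\<close>

text \<open>The initial tangent points vertically upward, so by continuity the tangents stay in a
  narrow cone about the vertical for a while. The mean value theorem, applied in the smooth
  parameter, puts the chords into the same cone; the result is stated in the original
  parameter.\<close>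

lemma C1_curve_in_cone:
  assumes "T > 0" and \<gamma>0: "\<gamma> 0 = 0" and pos: "\<And>t. t \<in> {0<..T} \<Longrightarrow> Im (\<gamma> t) > 0"
    and C1: "C1_curve_with_tangent \<gamma> T \<tau>" and perp: "orthogonal (\<tau> 0) (1 :: complex)" and "e > 0"
  obtains d where "0 < d" "d \<le> T" "\<And>s. 0 \<le> s \<Longrightarrow> s \<le> d \<Longrightarrow> \<bar>Re (\<tau> s)\<bar> < e * Im (\<tau> s)"
    "\<And>s1 s2. 0 \<le> s1 \<Longrightarrow> s1 < s2 \<Longrightarrow> s2 \<le> d \<Longrightarrow>
       \<bar>Re (\<gamma> s2) - Re (\<gamma> s1)\<bar> < e * (Im (\<gamma> s2) - Im (\<gamma> s1))"
proof -
  obtain L \<phi> where L: "0 < L" "strict_mono_on {0..L} \<phi>" "\<phi> ` {0..L} = {0..T}"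
    and der: "\<And>s. s \<in> {0..L} \<Longrightarrow> ((\<gamma> \<circ> \<phi>) has_vector_derivative \<tau> (\<phi> s)) (at s within {0..L})"
    and cont: "continuous_on {0..T} \<tau>" and nz: "\<And>t. t \<in> {0..T} \<Longrightarrow> \<tau> t \<noteq> 0"
    using C1 unfolding C1_curve_with_tangent_def by blast
  have less: "\<phi> x < \<phi> y \<longleftrightarrow> x < y" if "x \<in> {0..L}" "y \<in> {0..L}" for x y
    using strict_mono_on_less[OF L(2)] that by blast
  have range: "\<phi> x \<in> {0..T}" if "x \<in> {0..L}" for x using L(3) that by blast
  have "0 \<in> \<phi> ` {0..L}" using L(3) \<open>T > 0\<close> by simp
  then obtain x0 where x0: "x0 \<in> {0..L}" "\<phi> x0 = 0" by auto
  have "\<not> 0 < x0" using less[of 0 x0] x0 range[of 0] L(1) by auto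
  then have \<phi>0: "\<phi> 0 = 0" using x0 by auto
  have lin: "((\<lambda>x. a * Im (\<gamma> (\<phi> x)) + b * Re (\<gamma> (\<phi> x))) has_derivative
      (\<lambda>h. h * (a * Im (\<tau> (\<phi> x)) + b * Re (\<tau> (\<phi> x))))) (at x within {0..L})"
    if "x \<in> {0..L}" for a b x
  proof -
    have "((\<lambda>x. \<gamma> (\<phi> x)) has_derivative (\<lambda>h. h *\<^sub>R \<tau> (\<phi> x))) (at x within {0..L})"
      using der[OF that] by (simp add: has_vector_derivative_def comp_def)
    note * = has_derivative_Im[OF this] has_derivative_Re[OF this]
    show ?thesis
      by (rule has_derivative_eq_rhs, rule has_derivative_add; (rule has_derivative_mult_right, rule *)?)
        (auto simp: algebra_simps)
  qed
  have Re0: "Re (\<tau> 0) = 0" using perp by (simp add: orthogonal_def inner_complex_def)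
  then have Im0: "Im (\<tau> 0) \<noteq> 0" using nz[of 0] \<open>T > 0\<close> by (auto simp: complex_eq_iff)
  \<comment> \<open>A downward tangent would carry the curve below the real axis
    immediately.\<close>
  have "\<not> Im (\<tau> 0) < 0"
  proof
    assume neg: "Im (\<tau> 0) < 0"
    have "((\<lambda>x. Im (\<gamma> (\<phi> x))) has_real_derivative Im (\<tau> 0)) (at 0 within {0..L})"
      using lin[of 0 1 0] L(1) \<phi>0 by (simp add: has_field_derivative_def mult_commute_abs)
    from has_real_derivative_neg_dec_right[OF this neg] obtain d where d: "d > 0"
      "\<And>h. h > 0 \<Longrightarrow> 0 + h \<in> {0..L} \<Longrightarrow> h < d \<Longrightarrow> Im (\<gamma> (\<phi> (0 + h))) < Im (\<gamma> (\<phi> 0))" by blast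
    define x where "x = min (d / 2) L"
    have x: "0 < x" "x \<in> {0..L}" "x < d" using d(1) L(1) by (auto simp: x_def)
    then have "Im (\<gamma> (\<phi> x)) < 0" using d(2)[of x] \<phi>0 \<gamma>0 by simp
    moreover have "\<phi> x \<in> {0<..T}" using less[of 0 x] x L(1) \<phi>0 range[OF x(2)] by auto
    ultimately show False using pos[of "\<phi> x"] by simp
  qed
  then have Im0: "Im (\<tau> 0) > 0" using Im0 by simp
  have "(\<tau> \<longlongrightarrow> \<tau> 0) (at 0 within {0..T})" using cont \<open>T > 0\<close> by (auto simp: continuous_on_def)
  then have "((\<lambda>s. e * Im (\<tau> s) - \<bar>Re (\<tau> s)\<bar>) \<longlongrightarrow> e * Im (\<tau> 0) - \<bar>Re (\<tau> 0)\<bar>) (at 0 within {0..T})"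
    by (intro tendsto_intros)
  moreover have "e * Im (\<tau> 0) - \<bar>Re (\<tau> 0)\<bar> > 0" using Im0 Re0 \<open>e > 0\<close> by simp
  ultimately have "\<forall>\<^sub>F s in at 0 within {0..T}. e * Im (\<tau> s) - \<bar>Re (\<tau> s)\<bar> > 0"
    by (rule order_tendstoD(1))
  then obtain d0 where d0: "d0 > 0" "\<And>s. s \<in> {0..T} \<Longrightarrow> s \<noteq> 0 \<Longrightarrow> \<bar>s\<bar> < d0 \<Longrightarrow> \<bar>Re (\<tau> s)\<bar> < e * Im (\<tau> s)"
    unfolding eventually_at by (auto simp: dist_real_def)
  define d where "d = min (d0 / 2) T"
  have d: "0 < d" "d \<le> T" using d0(1) \<open>T > 0\<close> by (auto simp: d_def)
  have cone: "\<bar>Re (\<tau> s)\<bar> < e * Im (\<tau> s)" if "0 \<le> s" "s \<le> d" for s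
    using d0(2)[of s] d0(1) that Re0 Im0 \<open>e > 0\<close> by (cases "s = 0") (auto simp: d_def)
  show ?thesis
  proof (rule that[OF d cone])
    fix s1 s2 assume s: "0 \<le> s1" "s1 < s2" "s2 \<le> d"
    have "s1 \<in> \<phi> ` {0..L}" "s2 \<in> \<phi> ` {0..L}" unfolding L(3) using s d by auto
    then obtain x1 x2 where x: "x1 \<in> {0..L}" "x2 \<in> {0..L}" "s1 = \<phi> x1" "s2 = \<phi> x2" by auto
    then have "x1 < x2" using s less by blast
    have sub: "{x1..x2} \<subseteq> {0..L}" using x by auto
    \<comment> \<open>The cone is the intersection of two half-planes, so the scalar mean value
      theorem is applied to the real functions e Im + Re and e Im - Re along the curve.\<close>
    have "0 < e * (Im (\<gamma> s2) - Im (\<gamma> s1)) + k * (Re (\<gamma> s2) - Re (\<gamma> s1))" if k: "k = 1 \<or> k = -1" for k :: real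
    proof -
      have "\<exists>x\<in>{x1<..<x2}. (e * Im (\<gamma> (\<phi> x2)) + k * Re (\<gamma> (\<phi> x2))) - (e * Im (\<gamma> (\<phi> x1)) + k * Re (\<gamma> (\<phi> x1)))
          = (x2 - x1) * (e * Im (\<tau> (\<phi> x)) + k * Re (\<tau> (\<phi> x)))"
        using \<open>x1 < x2\<close> sub has_derivative_subset[OF lin sub] by (intro mvt_simple) auto
      then obtain x where xx: "x1 < x" "x < x2" and eq: "(e * Im (\<gamma> (\<phi> x2)) + k * Re (\<gamma> (\<phi> x2))) - (e * Im (\<gamma> (\<phi> x1)) + k * Re (\<gamma> (\<phi> x1)))
          = (x2 - x1) * (e * Im (\<tau> (\<phi> x)) + k * Re (\<tau> (\<phi> x)))" by auto
      have xL: "x \<in> {0..L}" using xx x by auto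
      have "\<phi> x \<le> d" using less[OF xL x(2)] xx s x by auto
      then have "0 < e * Im (\<tau> (\<phi> x)) + k * Re (\<tau> (\<phi> x))"
        using cone[of "\<phi> x"] range[OF xL] k by auto
      then have "0 < (x2 - x1) * (e * Im (\<tau> (\<phi> x)) + k * Re (\<tau> (\<phi> x)))" using \<open>x1 < x2\<close> by simp
      then show ?thesis using eq x by (simp add: algebra_simps)
    qed
    from this[of 1] this[of "-1"]
    show "\<bar>Re (\<gamma> s2) - Re (\<gamma> s1)\<bar> < e * (Im (\<gamma> s2) - Im (\<gamma> s1))" by auto
  qed
qed

text \<open>The cone condition makes the height strictly increasing along the curve, so the height
  can serve as parameter, and the opening of the cone becomes the Lipschitz constant.\<close>

lemma curve_in_cone_is_graph:
  assumes "0 < t" and cont: "continuous_on {0..t} \<gamma>" and \<gamma>0: "\<gamma> 0 = 0" and e: "0 < e" "e \<le> 1"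
    and cone: "\<And>s1 s2. 0 \<le> s1 \<Longrightarrow> s1 < s2 \<Longrightarrow> s2 \<le> t \<Longrightarrow>
       \<bar>Re (\<gamma> s2) - Re (\<gamma> s1)\<bar> < e * (Im (\<gamma> s2) - Im (\<gamma> s1))"
  obtains g where "graph_slit g (Im (\<gamma> t)) e" "slit_domain \<gamma> t = graph_slit.dom g (Im (\<gamma> t))"
    "\<And>y. 0 < y \<Longrightarrow> y < Im (\<gamma> t) \<Longrightarrow> \<exists>s\<in>{0<..<t}. \<gamma> s = Complex (g y) y"
proof -
  have mono: "Im (\<gamma> s1) < Im (\<gamma> s2)" if "0 \<le> s1" "s1 < s2" "s2 \<le> t" for s1 s2
  proof -
    have "0 < e * (Im (\<gamma> s2) - Im (\<gamma> s1))" using cone[OF that] by linarith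
    then show ?thesis using e by (simp add: zero_less_mult_iff)
  qed
  have cone': "\<bar>Re (\<gamma> s2) - Re (\<gamma> s1)\<bar> \<le> e * \<bar>Im (\<gamma> s2) - Im (\<gamma> s1)\<bar>" if "s1 \<in> {0..t}" "s2 \<in> {0..t}" for s1 s2
    using cone[of s1 s2] cone[of s2 s1] mono[of s1 s2] mono[of s2 s1] that
    by (cases s1 s2 rule: linorder_cases) (auto simp: abs_minus_commute)
  define h where "h = Im (\<gamma> t)"
  have h: "0 < h" using mono[of 0 t] \<open>0 < t\<close> \<gamma>0 by (simp add: h_def)
  have surj: "\<exists>s\<in>{0..t}. Im (\<gamma> s) = y" if "0 \<le> y" "y \<le> h" for y
  proof -
    have "continuous_on {0..t} (\<lambda>s. Im (\<gamma> s))" using cont by (intro continuous_intros)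
    then show ?thesis using IVT'[of "\<lambda>s. Im (\<gamma> s)" 0 y t] that \<open>0 < t\<close> \<gamma>0 by (auto simp: h_def)
  qed
  define s where "s y = inv_into {0..t} (\<lambda>s. Im (\<gamma> s)) y" for y
  have s: "s y \<in> {0..t}" "Im (\<gamma> (s y)) = y" if "0 \<le> y" "y \<le> h" for y
  proof -
    have "y \<in> (\<lambda>s. Im (\<gamma> s)) ` {0..t}" using surj[OF that] by auto
    then show "s y \<in> {0..t}" "Im (\<gamma> (s y)) = y"
      unfolding s_def by (rule inv_into_into, rule f_inv_into_f)
  qed
  have inj: "s1 = s2" if "s1 \<in> {0..t}" "s2 \<in> {0..t}" "Im (\<gamma> s1) = Im (\<gamma> s2)" for s1 s2
    using mono[of s1 s2] mono[of s2 s1] that by (cases s1 s2 rule: linorder_cases) auto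
  \<comment> \<open>Clamping the height to the interval from 0 to \<open>h\<close> extends the graph
    by constants and does not increase distances, so the Lipschitz bound survives.\<close>
  define g where "g y = Re (\<gamma> (s (max 0 (min y h))))" for y
  have clamp: "0 \<le> max 0 (min y h)" "max 0 (min y h) \<le> h" for y using h by auto
  have curve: "\<gamma> r = Complex (g (Im (\<gamma> r))) (Im (\<gamma> r))" and Im: "0 \<le> Im (\<gamma> r)" "Im (\<gamma> r) \<le> h"
    if r: "r \<in> {0..t}" for r
  proof -
    show "0 \<le> Im (\<gamma> r)" "Im (\<gamma> r) \<le> h"
      using mono[of 0 r] mono[of r t] r \<gamma>0 by (cases "r = 0"; cases "r = t"; auto simp: h_def)+
    then have "s (max 0 (min (Im (\<gamma> r)) h)) = r"
      using inj[OF s(1) r] s(2) by (simp add: max_def min_def)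
    then show "\<gamma> r = Complex (g (Im (\<gamma> r))) (Im (\<gamma> r))" by (simp add: g_def complex_eq_iff)
  qed
  have gs: "graph_slit g h e"
  proof
    show "0 < h" "0 \<le> e" "e \<le> 1" using h e by auto
    show "\<bar>g x - g y\<bar> \<le> e * \<bar>x - y\<bar>" for x y
    proof -
      have "\<bar>g x - g y\<bar> \<le> e * \<bar>max 0 (min x h) - max 0 (min y h)\<bar>"
        unfolding g_def using cone'[OF s(1) s(1)] s(2) clamp by metis
      also have "\<dots> \<le> e * \<bar>x - y\<bar>" using e by (intro mult_left_mono) auto
      finally show ?thesis .
    qed
    show "g 0 = 0" using curve[of 0] \<open>0 < t\<close> \<gamma>0 by (simp add: complex_eq_iff)
    show "g y = g h" if "h \<le> y" for y using that by (simp add: g_def)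
  qed
  have "\<gamma> ` {0..t} = graph_slit.slit g h"
  proof (intro equalityI subsetI)
    fix z assume "z \<in> \<gamma> ` {0..t}"
    then show "z \<in> graph_slit.slit g h"
      using curve Im by (auto simp: graph_slit.slit_def[OF gs]) (metis complex.sel(1))
  next
    fix z assume "z \<in> graph_slit.slit g h"
    then have z: "0 \<le> Im z" "Im z \<le> h" "Re z = g (Im z)" by (auto simp: graph_slit.slit_def[OF gs])
    then obtain r where "r \<in> {0..t}" "Im (\<gamma> r) = Im z" using surj by blast
    then show "z \<in> \<gamma> ` {0..t}" using curve[of r] z by (auto simp: complex_eq_iff intro!: image_eqI[of _ _ r])
  qed
  then have "slit_domain \<gamma> t = graph_slit.dom g h"
    by (simp add: slit_domain_def graph_slit.dom_def[OF gs])
  moreover have "\<exists>r\<in>{0<..<t}. \<gamma> r = Complex (g y) y" if y: "0 < y" "y < h" for y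
  proof -
    obtain r where r: "r \<in> {0..t}" "Im (\<gamma> r) = y" using surj[of y] y by auto
    then have "r \<noteq> 0" "r \<noteq> t" using y \<gamma>0 by (auto simp: h_def)
    then show ?thesis using r curve[OF r(1)] by (intro bexI[of _ r]) auto
  qed
  ultimately show ?thesis using that[of g] gs by (simp add: h_def)
qed

section \<open>The motion of a point under the Loewner equation\<close>

text \<open>In the upper half-plane the velocity 2 / (w - lam) has nonpositive imaginary part, so
  the height is at least its final value 1 throughout. The distance to the driving point is then at
  least 1 and the speed at most 2.\<close>

lemma loewner_displacement_le:
  fixes w :: "real \<Rightarrow> complex" and lam :: "real \<Rightarrow> real"
  assumes "0 \<le> t"
    and pos: "\<And>s. s \<in> {0..t} \<Longrightarrow> Im (w s) > 0"
    and ode: "\<And>s. s \<in> {0..t} \<Longrightarrow> (w has_vector_derivative 2 / (w s - of_real (lam s))) (at s within {0..t})"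
    and end1: "Im (w t) \<ge> 1"
  shows "cmod (w t - w 0) \<le> 2 * t"
proof -
  have der: "(w has_derivative (\<lambda>h. h *\<^sub>R (2 / (w s - of_real (lam s))))) (at s within {0..t})" if "s \<in> {0..t}" for s
    using ode[OF that] by (simp add: has_vector_derivative_def)
  have ge1: "Im (w s) \<ge> 1" if s: "s \<in> {0..t}" for s
  proof (cases "s = t")
    case False
    then have "s < t" using s by simp
    have sub: "{s..t} \<subseteq> {0..t}" using s by auto
    have "\<exists>x\<in>{s<..<t}. Im (w t) - Im (w s) = Im ((t - s) *\<^sub>R (2 / (w x - of_real (lam x))))"
      using \<open>s < t\<close> sub has_derivative_subset[OF has_derivative_Im[OF der] sub] by (intro mvt_simple) auto
    then obtain x where x: "s < x" "x < t" "Im (w t) - Im (w s) = Im ((t - s) *\<^sub>R (2 / (w x - of_real (lam x))))" by auto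
    have "Im (2 / (w x - of_real (lam x))) \<le> 0"
      using pos[of x] x s by (simp add: Im_divide divide_nonpos_nonneg)
    then have "Im (w t) - Im (w s) \<le> 0"
      unfolding x(3) using \<open>s < t\<close> by (simp add: mult_nonneg_nonpos)
    then show ?thesis using end1 by simp
  qed (use end1 in simp)
  show ?thesis
  proof (cases "t = 0")
    case False
    then have "0 < t" using \<open>0 \<le> t\<close> by simp
    have "\<exists>x\<in>{0<..<t}. norm (w t - w 0) \<le> norm ((t - 0) *\<^sub>R (2 / (w x - of_real (lam x))))"
    proof (rule mvt_general[OF \<open>0 < t\<close>])
      show "continuous_on {0..t} w"
        by (rule has_derivative_continuous_on[OF der])
      show "(w has_derivative (\<lambda>h. h *\<^sub>R (2 / (w x - of_real (lam x))))) (at x)" if "0 < x" "x < t" for x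
        using der[of x] that by (simp add: at_within_Icc_at)
    qed
    then obtain x where x: "0 < x" "x < t" "norm (w t - w 0) \<le> norm (t *\<^sub>R (2 / (w x - of_real (lam x))))" by auto
    have "1 \<le> Im (w x - of_real (lam x))" using ge1[of x] x by simp
    also have "\<dots> \<le> cmod (w x - of_real (lam x))" using abs_Im_le_cmod[of "w x - of_real (lam x)"] by linarith
    finally have "2 / cmod (w x - of_real (lam x)) \<le> 2" by (simp add: divide_le_eq)
    then have "t * (2 / cmod (w x - of_real (lam x))) \<le> t * 2" using \<open>0 < t\<close> by (intro mult_left_mono) auto
    then show ?thesis using x(3) \<open>0 < t\<close> by (simp add: norm_divide)
  qed simp
qed

section \<open>The limit of the ratio\<close>

text \<open>With k \<le> 1/2 the difference is at most half the sum, so \<open>b\<close> is at least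
  a quarter of the sum. This gives both the positivity of the denominator and the factor 4.\<close>

lemma ratio_near_1:
  fixes a b k :: real
  assumes "0 < a + b" "\<bar>a - b\<bar> \<le> k * (a + b)" "0 \<le> k" "k \<le> 1/2"
  shows "\<bar>a / b - 1\<bar> \<le> 4 * k"
proof -
  have "k * (a + b) \<le> 1/2 * (a + b)" using assms by (intro mult_right_mono) auto
  then have "\<bar>a - b\<bar> \<le> 1/2 * (a + b)" using assms(2) by (rule order_trans[rotated])
  then have b: "a + b \<le> 4 * b" by (simp add: abs_if split: if_splits)
  then have bpos: "0 < b" using assms(1) by linarith
  have "\<bar>a - b\<bar> \<le> k * (4 * b)"
    using assms(2) mult_left_mono[OF b \<open>0 \<le> k\<close>] by (rule order_trans)
  moreover have "a / b - 1 = (a - b) / b" using bpos by (simp add: diff_divide_distrib)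
  then have "\<bar>a / b - 1\<bar> = \<bar>a - b\<bar> / b" using bpos by (simp add: abs_divide)
  ultimately show ?thesis using bpos by (simp add: divide_le_eq mult.assoc)
qed

theorem theorem1:
  fixes T :: real
    and \<gamma> \<tau> :: "real \<Rightarrow> complex"
    and f :: "complex \<Rightarrow> real \<Rightarrow> complex"
    and lam :: "real \<Rightarrow> real"
    and \<omega>1 \<omega>2 :: "real \<Rightarrow> complex \<Rightarrow> real"
  assumes "T > 0"
    and "continuous_on {0..T} \<gamma>" and "inj_on \<gamma> {0..T}"
    and "\<gamma> 0 = 0" and "\<And>t. t \<in> {0<..T} \<Longrightarrow> Im (\<gamma> t) > 0"
    and "C1_curve_with_tangent \<gamma> T \<tau>"
    and "orthogonal (\<tau> 0) (1 :: complex)"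
    and "\<And>t. t \<in> {0..T} \<Longrightarrow> (\<lambda>z. f z t) holomorphic_on slit_domain \<gamma> t"
    and "\<And>t. t \<in> {0..T} \<Longrightarrow> bij_betw (\<lambda>z. f z t) (slit_domain \<gamma> t) upper_half_plane"
    and "\<And>t. t \<in> {0..T} \<Longrightarrow>
           (\<lambda>z. f z t - (z + 2 * of_real t / z))
             \<in> O[inf at_infinity (principal (slit_domain \<gamma> t))](\<lambda>z. 1 / z ^ 2)"
    and "continuous_on {0..T} lam"
    and "\<And>z. z \<in> upper_half_plane \<Longrightarrow> f z 0 = z"
    and "\<And>t z. t \<in> {0..T} \<Longrightarrow> z \<in> slit_domain \<gamma> t \<Longrightarrow>
           ((\<lambda>s. f z s) has_vector_derivative 2 / (f z t - of_real (lam t))) (at t within {0..T})"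
    and "\<And>t. t \<in> {0<..T} \<Longrightarrow> harmonic_measure_of_side \<gamma> (\<lambda>s. - \<i> * \<tau> s) t (\<omega>1 t)"
    and "\<And>t. t \<in> {0<..T} \<Longrightarrow> harmonic_measure_of_side \<gamma> (\<lambda>s. \<i> * \<tau> s) t (\<omega>2 t)"
  defines "m1 \<equiv> \<lambda>t. \<omega>1 t (inv_into (slit_domain \<gamma> t) (\<lambda>z. f z t) \<i>)"
    and "m2 \<equiv> \<lambda>t. \<omega>2 t (inv_into (slit_domain \<gamma> t) (\<lambda>z. f z t) \<i>)"
  shows "((\<lambda>t. m1 t / m2 t) \<longlongrightarrow> 1) (at_right 0)"
proof (rule tendstoI)
  note bij = assms(9) and ode = assms(13) and hm1 = assms(14) and hm2 = assms(15)
  define Z where "Z t = inv_into (slit_domain \<gamma> t) (\<lambda>z. f z t) \<i>" for t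
  have Z: "cmod (Z t - \<i>) \<le> 2 * t" if t: "t \<in> {0..T}" for t
  proof -
    have surj: "(\<lambda>z. f z t) ` slit_domain \<gamma> t = upper_half_plane"
      using bij[OF t] by (rule bij_betw_imp_surj_on)
    have "\<i> \<in> (\<lambda>z. f z t) ` slit_domain \<gamma> t" unfolding surj by (simp add: upper_half_plane_def)
    then have Zt: "Z t \<in> slit_domain \<gamma> t" "f (Z t) t = \<i>"
      unfolding Z_def by (rule inv_into_into, rule f_inv_into_f)
    \<comment> \<open>The slits grow with time, so the trajectory of this point is defined up to
      time \<open>t\<close>, when it arrives at \<i>.\<close>
    have Zs: "Z t \<in> slit_domain \<gamma> s" if "s \<in> {0..t}" for s
      using Zt(1) that by (auto simp: slit_domain_def)
    have "cmod (f (Z t) t - f (Z t) 0) \<le> 2 * t"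
    proof (rule loewner_displacement_le)
      fix s assume s: "s \<in> {0..t}"
      then have sT: "s \<in> {0..T}" using t by auto
      show "Im (f (Z t) s) > 0"
        using bij_betw_apply[OF bij[OF sT] Zs[OF s]] by (simp add: upper_half_plane_def)
      show "((\<lambda>s. f (Z t) s) has_vector_derivative 2 / (f (Z t) s - of_real (lam s))) (at s within {0..t})"
        using t by (intro has_vector_derivative_within_subset[OF ode[OF sT Zs[OF s]]]) auto
    qed (use t Zt in auto)
    moreover have "f (Z t) 0 = Z t" using Zt(1) by (intro assms(12)) (auto simp: slit_domain_def)
    ultimately show ?thesis using Zt(2) by (simp add: norm_minus_commute)
  qed
  fix \<eta> :: real assume "0 < \<eta>"
  \<comment> \<open>\<open>k\<close> will bound the relative difference of the two measures: 1/2 is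
    the limit allowed by \<open>ratio_near_1\<close>, and \<eta> / 8 makes the resulting error 4 k
    smaller than \<eta>.\<close>
  define k where "k = min (1/2) (\<eta> / 8)"
  have k: "0 < k" "k \<le> 1/2" "4 * k < \<eta>" using \<open>0 < \<eta>\<close> by (auto simp: k_def)
  \<comment> \<open>Half of \<open>k\<close> is reserved for 290 e, the other half for 1152 h; hence
    580 here and the threshold k / 2304 for the height below.\<close>
  define e where "e = k / 580"
  have e: "0 < e" "e \<le> 1" "e < 1" "290 * e \<le> k / 2" using k by (auto simp: e_def)
  obtain d where d: "0 < d" "d \<le> T"
    and tangent: "\<And>s. 0 \<le> s \<Longrightarrow> s \<le> d \<Longrightarrow> \<bar>Re (\<tau> s)\<bar> < e * Im (\<tau> s)"
    and cone: "\<And>s1 s2. 0 \<le> s1 \<Longrightarrow> s1 < s2 \<Longrightarrow> s2 \<le> d \<Longrightarrow>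
       \<bar>Re (\<gamma> s2) - Re (\<gamma> s1)\<bar> < e * (Im (\<gamma> s2) - Im (\<gamma> s1))"
    using C1_curve_in_cone[OF assms(1,4,5,6,7) e(1)] by blast
  have "((\<lambda>t. Im (\<gamma> t)) \<longlongrightarrow> Im (\<gamma> 0)) (at 0 within {0..T})"
    using assms(1,2) by (intro tendsto_intros) (auto simp: continuous_on_def)
  then have "\<forall>\<^sub>F t in at 0 within {0..T}. Im (\<gamma> t) < k / 2304"
    using assms(4) k by (intro order_tendstoD(2)) auto
  then obtain d1 where d1: "d1 > 0" "\<And>t. t \<in> {0..T} \<Longrightarrow> t \<noteq> 0 \<Longrightarrow> \<bar>t\<bar> < d1 \<Longrightarrow> Im (\<gamma> t) < k / 2304"
    unfolding eventually_at by (auto simp: dist_real_def)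
  \<comment> \<open>The bound 1/8 keeps the preimage of \<i> within 2 t \<le> 1/4 of \<i>, where the
    estimates hold.\<close>
  have close: "dist (m1 t / m2 t) 1 < \<eta>" if t: "0 < t" "t < min d (min d1 (1/8))" for t
  proof -
    have tT: "t \<in> {0<..T}" using t d by auto
    define h where "h = Im (\<gamma> t)"
    have h: "h < k / 2304" using d1(2)[of t] t tT by (simp add: h_def)
    have cont_t: "continuous_on {0..t} \<gamma>" using tT by (intro continuous_on_subset[OF assms(2)]) auto
    have cone_t: "\<bar>Re (\<gamma> s2) - Re (\<gamma> s1)\<bar> < e * (Im (\<gamma> s2) - Im (\<gamma> s1))"
      if "0 \<le> s1" "s1 < s2" "s2 \<le> t" for s1 s2
      using cone that t by auto
    obtain g where gs: "graph_slit g h e" and dom: "slit_domain \<gamma> t = graph_slit.dom g h"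
      and param: "\<And>y. 0 < y \<Longrightarrow> y < h \<Longrightarrow> \<exists>s\<in>{0<..<t}. \<gamma> s = Complex (g y) y"
      using curve_in_cone_is_graph[where \<gamma> = \<gamma>, OF t(1) cont_t assms(4) e(1,2) cone_t, folded h_def] by blast
    interpret graph_slit g h e by (rule gs)
    \<comment> \<open>Turning the nearly vertical tangent by - \<i> gives a nearly horizontal normal
      pointing to the right: its real part is Im (\<tau> s) and its imaginary part - Re (\<tau> s),
      so the tangent cone with e \<le> 1 gives the condition on the normal.\<close>
    have sides: "at (Complex (g y) y) within right \<le> at_side dom (\<gamma> s) (- \<i> * \<tau> s)"
      "at (Complex (g y) y) within left \<le> at_side dom (\<gamma> s) (\<i> * \<tau> s)"
      if "0 < y" "y < h" "s \<in> {0<..<t}" "\<gamma> s = Complex (g y) y" for y s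
    proof -
      have "\<bar>Re (\<tau> s)\<bar> < e * Im (\<tau> s)" using tangent[of s] that t by auto
      moreover from this have "0 < Im (\<tau> s)" using e by (smt (verit) mult_nonneg_nonpos)
      then have "e * Im (\<tau> s) \<le> 1 * Im (\<tau> s)" using e by (intro mult_right_mono) auto
      moreover have "e * \<bar>Re (\<tau> s)\<bar> \<le> 1 * \<bar>Re (\<tau> s)\<bar>" using e by (intro mult_right_mono) auto
      ultimately have "e * \<bar>Re (\<tau> s)\<bar> < Im (\<tau> s)" by linarith
      then show "at (Complex (g y) y) within right \<le> at_side dom (\<gamma> s) (- \<i> * \<tau> s)"
        "at (Complex (g y) y) within left \<le> at_side dom (\<gamma> s) (\<i> * \<tau> s)"
        unfolding that(4) using that(1,2) by (auto intro!: at_right_side_le at_left_side_le)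
    qed
    have 1: "harmonic_on (\<omega>1 t) dom" "bounded (\<omega>1 t ` dom)"
      "\<And>s. s \<in> {0<..<t} \<Longrightarrow> (\<omega>1 t \<longlongrightarrow> 1) (at_side dom (\<gamma> s) (- \<i> * \<tau> s))"
      "\<And>s. s \<in> {0<..<t} \<Longrightarrow> (\<omega>1 t \<longlongrightarrow> 0) (at_side dom (\<gamma> s) (\<i> * \<tau> s))"
      "\<And>x. x \<noteq> 0 \<Longrightarrow> (\<omega>1 t \<longlongrightarrow> 0) (at (of_real x) within dom)"
      using hm1[OF tT] unfolding harmonic_measure_of_side_def dom by auto
    have 2: "harmonic_on (\<omega>2 t) dom" "bounded (\<omega>2 t ` dom)"
      "\<And>s. s \<in> {0<..<t} \<Longrightarrow> (\<omega>2 t \<longlongrightarrow> 1) (at_side dom (\<gamma> s) (\<i> * \<tau> s))"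
      "\<And>s. s \<in> {0<..<t} \<Longrightarrow> (\<omega>2 t \<longlongrightarrow> 0) (at_side dom (\<gamma> s) (- \<i> * \<tau> s))"
      "\<And>x. x \<noteq> 0 \<Longrightarrow> (\<omega>2 t \<longlongrightarrow> 0) (at (of_real x) within dom)"
      using hm2[OF tT] unfolding harmonic_measure_of_side_def dom by auto
    have lim: "(\<omega>1 t \<longlongrightarrow> 1) (at (Complex (g y) y) within right)"
      "(\<omega>1 t \<longlongrightarrow> 0) (at (Complex (g y) y) within left)"
      "(\<omega>2 t \<longlongrightarrow> 0) (at (Complex (g y) y) within right)"
      "(\<omega>2 t \<longlongrightarrow> 1) (at (Complex (g y) y) within left)" if y: "0 < y" "y < h" for y
    proof -
      obtain s where s: "s \<in> {0<..<t}" "\<gamma> s = Complex (g y) y" using param[OF y] by blast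
      note * = tendsto_mono[OF sides(1)[OF y s]] tendsto_mono[OF sides(2)[OF y s]]
      show "(\<omega>1 t \<longlongrightarrow> 1) (at (Complex (g y) y) within right)"
        "(\<omega>1 t \<longlongrightarrow> 0) (at (Complex (g y) y) within left)"
        "(\<omega>2 t \<longlongrightarrow> 0) (at (Complex (g y) y) within right)"
        "(\<omega>2 t \<longlongrightarrow> 1) (at (Complex (g y) y) within left)"
        using *(1)[OF 1(3)[OF s(1)]] *(2)[OF 1(4)[OF s(1)]] *(1)[OF 2(4)[OF s(1)]] *(2)[OF 2(3)[OF s(1)]]
        by auto
    qed
    have "cmod (Z t - \<i>) \<le> 1/4" using Z[of t] t tT by auto
    moreover have "h \<le> 1/16" using h k by simp
    ultimately have pos: "0 < m1 t + m2 t"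
      and le: "\<bar>m1 t - m2 t\<bar> \<le> (290 * e + 1152 * h) * (m1 t + m2 t)"
      using harmonic_measures_near_i[OF 1(1,2) 2(1,2) lim 1(5) 2(5), of "Z t"]
      by (simp_all add: m1_def m2_def Z_def)
    have "290 * e + 1152 * h \<le> k" using e h by simp
    then have "(290 * e + 1152 * h) * (m1 t + m2 t) \<le> k * (m1 t + m2 t)"
      using pos by (intro mult_right_mono) auto
    from order_trans[OF le this] have "\<bar>m1 t / m2 t - 1\<bar> \<le> 4 * k"
      using pos k by (intro ratio_near_1) auto
    then show ?thesis using k by (simp add: dist_real_def)
  qed
  show "\<forall>\<^sub>F t in at_right 0. dist (m1 t / m2 t) 1 < \<eta>"
    unfolding eventually_at_right_field
    using close d d1(1) by (intro exI[of _ "min d (min d1 (1/8))"]) auto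
qed

end
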